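(* Let $n\ge 2$ be an integer and let $SD_{8n}=\langle a,b\mid a^{4n}=b^2=e,\ ba=a^{2n-1}b\rangle$ be the semidihedral group of order $8n$. If the cyclic subgroup $\langle a\rangle$ is isomorphic to $\mathbb{Z}_{2^k}\times\mathbb{Z}_p$, where $p\neq 2$ is a prime and $k>1$, then $$\dim(\mathcal{D}(SD_{8n}))=4n-\phi(4n)-\tau(4n)+2.$$ Otherwise, $$\dim(\mathcal{D}(SD_{8n}))=4n-\phi(4n)-\tau(4n)+1.$$
   Context: For a finite group $G$, the power graph $\mathcal{P}(G)$ is the simple graph with vertex set $G$ in which distinct $x,y$ are adjacent iff $x\in\langle y\rangle$ or $y\in\langle x\rangle$. The enhanced power graph $\mathcal{P}_E(G)$ is the simple graph with vertex set $G$ in which distinct $x,y$ are adjacent iff both belong to some common cyclic subgroup of $G$. The difference graph $\mathcal{D}(G)$ is obtained from $\mathcal{P}_E(G)$ by removing all edges of $\mathcal{P}(G)$ and then deleting all isolated vertices. A set $W$ of vertices of a graph is a resolving set if for every pair of distinct vertices $u,v$ there is $z\in W$ with $d(u,z)\ne d(v,z)$, where $d$ is graph distance; the metric dimension $\dim(\Gamma)$ is the minimum size of a resolving set of $\Gamma$. $\phi$ is Euler's totient function and $\tau(m)$ is the number of positive divisors of $m$.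
   Formalization: In the "Otherwise" case the difference graph is assumed to have at least one vertex; this excludes exactly n a power of 2, where the graph is empty (dimension 0) while the stated formula gives a positive value (e.g. 1 for n=2). *)

theory Defs
  imports
    "HOL-Algebra.Elementary_Groups"
    "HOL-Number_Theory.Totient"
    "Graph_Theory.Graph_Theory"
begin

section \<open>Groups given by generators and relations\<close>

text \<open>
  A letter \<open>(g, True)\<close> stands for the generator \<open>g\<close> and \<open>(g, False)\<close> for its formal inverse;
  a pair \<open>(l, r)\<close> of words stands for the relation \<open>l = r\<close>.
\<close>

type_synonym 'g word = "('g \<times> bool) list"

inductive pres_eq :: "('g word \<times> 'g word) set \<Rightarrow> 'g word \<Rightarrow> 'g word \<Rightarrow> bool"
  for R :: "('g word \<times> 'g word) set" where
  pres_refl: "pres_eq R u u"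
| pres_sym: "pres_eq R u v \<Longrightarrow> pres_eq R v u"
| pres_trans: "pres_eq R u v \<Longrightarrow> pres_eq R v w \<Longrightarrow> pres_eq R u w"
| pres_cancel: "pres_eq R (u @ [(g, s), (g, \<not> s)] @ v) (u @ v)"
| pres_relation: "(l, r) \<in> R \<Longrightarrow> pres_eq R (u @ l @ v) (u @ r @ v)"

definition pres_class :: "('g word \<times> 'g word) set \<Rightarrow> 'g word \<Rightarrow> 'g word set" where
  "pres_class R u = {v. pres_eq R u v}"

definition presented_group :: "('g word \<times> 'g word) set \<Rightarrow> 'g word set monoid" where
  "presented_group R =
    \<lparr>carrier = range (pres_class R),
     monoid.mult = (\<lambda>X Y. \<Union>u\<in>X. \<Union>v\<in>Y. pres_class R (u @ v)),
     one = pres_class R []\<rparr>"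

lemma carrier_presented_group: "carrier (presented_group R) = range (pres_class R)"
  and one_presented_group: "\<one>\<^bsub>presented_group R\<^esub> = pres_class R []"
  by (simp_all add: presented_group_def)

lemma pres_eq_context: "pres_eq R u v \<Longrightarrow> pres_eq R (x @ u @ y) (x @ v @ y)"
proof (induction rule: pres_eq.induct)
  case (pres_cancel u g s v)
  show ?case using pres_eq.pres_cancel[of R "x @ u" g s "v @ y"] by simp
next
  case (pres_relation l r u v)
  then show ?case using pres_eq.pres_relation[of l r R "x @ u" "v @ y"] by simp
qed (blast intro: pres_eq.intros)+

lemma pres_eq_append: "pres_eq R u u' \<Longrightarrow> pres_eq R v v' \<Longrightarrow> pres_eq R (u @ v) (u' @ v')"
  by (rule pres_trans[of _ _ "u' @ v"])
    (use pres_eq_context[of R u u' "[]" v] pres_eq_context[of R v v' u' "[]"] in simp_all)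

lemma pres_class_eq_iff: "pres_class R u = pres_class R v \<longleftrightarrow> pres_eq R u v"
  unfolding pres_class_def using pres_refl pres_sym pres_trans by blast

lemma presented_group_mult:
  "pres_class R u \<otimes>\<^bsub>presented_group R\<^esub> pres_class R v = pres_class R (u @ v)"
proof -
  have "pres_class R (u' @ v') = pres_class R (u @ v)"
    if "u' \<in> pres_class R u" "v' \<in> pres_class R v" for u' v'
  proof -
    have "pres_eq R (u @ v) (u' @ v')"
      using that by (intro pres_eq_append) (simp_all add: pres_class_def)
    then show ?thesis by (simp add: pres_class_eq_iff pres_sym)
  qed
  moreover have "u \<in> pres_class R u" "v \<in> pres_class R v"
    by (auto simp: pres_class_def intro: pres_refl)
  ultimately have "(\<Union>u'\<in>pres_class R u. \<Union>v'\<in>pres_class R v. pres_class R (u' @ v')) = pres_class R (u @ v)"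
    by blast
  then show ?thesis
    by (simp add: presented_group_def)
qed

lemma pres_eq_left_inverse: "pres_eq R (map (\<lambda>(g, s). (g, \<not> s)) (rev u) @ u) []"
proof (induction u)
  case Nil
  show ?case by (simp add: pres_refl)
next
  case (Cons c u)
  obtain g s where c: "c = (g, s)" by force
  let ?i = "map (\<lambda>(g, s). (g, \<not> s)) (rev u)"
  have "pres_eq R (?i @ [(g, \<not> s), (g, \<not> \<not> s)] @ u) (?i @ u)"
    by (rule pres_cancel)
  from pres_trans[OF this Cons.IH] show ?case by (simp add: c)
qed

lemma group_presented_group: "group (presented_group R)"
proof (rule groupI)
  fix X assume "X \<in> carrier (presented_group R)"
  then obtain u where X: "X = pres_class R u" by (auto simp: carrier_presented_group)
  let ?Y = "pres_class R (map (\<lambda>(g, s). (g, \<not> s)) (rev u))"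
  have "?Y \<otimes>\<^bsub>presented_group R\<^esub> X = \<one>\<^bsub>presented_group R\<^esub>"
    by (simp only: X presented_group_mult one_presented_group pres_class_eq_iff pres_eq_left_inverse)
  then show "\<exists>Y\<in>carrier (presented_group R).
      Y \<otimes>\<^bsub>presented_group R\<^esub> X = \<one>\<^bsub>presented_group R\<^esub>"
    by (metis carrier_presented_group rangeI)
qed (auto simp: presented_group_mult carrier_presented_group one_presented_group)

datatype sd_gen = Gen_a | Gen_b

definition semidihedral_relations :: "nat \<Rightarrow> (sd_gen word \<times> sd_gen word) set" where
  "semidihedral_relations n =
    {(replicate (4 * n) (Gen_a, True), []),
     (replicate 2 (Gen_b, True), []),
     ([(Gen_b, True), (Gen_a, True)], replicate (2 * n - 1) (Gen_a, True) @ [(Gen_b, True)])}"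

definition semidihedral :: "nat \<Rightarrow> sd_gen word set monoid" where
  "semidihedral n = presented_group (semidihedral_relations n)"

definition semidihedral_a :: "nat \<Rightarrow> sd_gen word set" where
  "semidihedral_a n = pres_class (semidihedral_relations n) [(Gen_a, True)]"


section \<open>Graphs of a group\<close>

text \<open>A simple graph is encoded by its vertex set and its symmetric, irreflexive adjacency relation.\<close>

definition power_graph :: "('a, 'm) monoid_scheme \<Rightarrow> 'a pair_pre_digraph" where
  "power_graph G =
    \<lparr>pverts = carrier G,
     parcs = {(x, y). x \<in> carrier G \<and> y \<in> carrier G \<and> x \<noteq> y \<and>
       (x \<in> generate G {y} \<or> y \<in> generate G {x})}\<rparr>"

definition enhanced_power_graph :: "('a, 'm) monoid_scheme \<Rightarrow> 'a pair_pre_digraph" where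
  "enhanced_power_graph G =
    \<lparr>pverts = carrier G,
     parcs = {(x, y). x \<in> carrier G \<and> y \<in> carrier G \<and> x \<noteq> y \<and>
       (\<exists>C. subgroup C G \<and> cyclic_group (G\<lparr>carrier := C\<rparr>) \<and> x \<in> C \<and> y \<in> C)}\<rparr>"

definition remove_edges :: "'a pair_pre_digraph \<Rightarrow> ('a \<times> 'a) set \<Rightarrow> 'a pair_pre_digraph" where
  "remove_edges \<Gamma> E = \<lparr>pverts = pverts \<Gamma>, parcs = parcs \<Gamma> - E\<rparr>"

definition delete_isolated :: "'a pair_pre_digraph \<Rightarrow> 'a pair_pre_digraph" where
  "delete_isolated \<Gamma> =
    \<lparr>pverts = {x \<in> pverts \<Gamma>. \<exists>y. (x, y) \<in> parcs \<Gamma>}, parcs = parcs \<Gamma>\<rparr>"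

definition difference_graph :: "('a, 'm) monoid_scheme \<Rightarrow> 'a pair_pre_digraph" where
  "difference_graph G =
    delete_isolated (remove_edges (enhanced_power_graph G) (parcs (power_graph G)))"

lemma pair_graph_difference_graph:
  assumes "finite (carrier G)"
  shows "pair_graph (difference_graph G)"
proof -
  have "sym (parcs (difference_graph G))"
    by (auto simp: sym_def difference_graph_def delete_isolated_def remove_edges_def
        power_graph_def enhanced_power_graph_def)
  moreover have fin: "finite (pverts (difference_graph G))"
    using assms by (simp add: difference_graph_def delete_isolated_def remove_edges_def
        enhanced_power_graph_def)
  moreover have ends: "fst e \<in> pverts (difference_graph G) \<and> snd e \<in> pverts (difference_graph G)"
    if "e \<in> parcs (difference_graph G)" for e
    using that by (force simp: difference_graph_def delete_isolated_def remove_edges_def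
        power_graph_def enhanced_power_graph_def)
  moreover have "finite (parcs (difference_graph G))"
    by (rule finite_subset[OF _ finite_cartesian_product[OF fin fin]])
       (use ends in \<open>auto simp: mem_Times_iff\<close>)
  moreover have "fst e \<noteq> snd e" if "e \<in> parcs (difference_graph G)" for e
    using that by (auto simp: difference_graph_def delete_isolated_def remove_edges_def
        enhanced_power_graph_def)
  ultimately show ?thesis
    by unfold_locales (auto simp: symmetric_def)
qed


section \<open>Metric dimension\<close>

text \<open>The distance is infinite when there is no walk from \<open>u\<close> to \<open>v\<close>.\<close>

definition graph_dist :: "'a pair_pre_digraph \<Rightarrow> 'a \<Rightarrow> 'a \<Rightarrow> ereal" where
  "graph_dist \<Gamma> u v = wf_digraph.\<mu> (with_proj \<Gamma>) (\<lambda>_. 1) u v"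

definition resolving_set :: "'a pair_pre_digraph \<Rightarrow> 'a set \<Rightarrow> bool" where
  "resolving_set \<Gamma> W \<longleftrightarrow> W \<subseteq> pverts \<Gamma> \<and>
    (\<forall>u\<in>pverts \<Gamma>. \<forall>v\<in>pverts \<Gamma>. u \<noteq> v \<longrightarrow> (\<exists>z\<in>W. graph_dist \<Gamma> u z \<noteq> graph_dist \<Gamma> v z))"

text \<open>
  Note that the empty set resolves the graph without vertices, so this graph gets metric dimension
  0.  The difference graph has no vertices for instance when all elements of \<open>G\<close> have prime power
  order, which for \<open>semidihedral n\<close> means that \<open>n\<close> is a power of 2.
\<close>

definition metric_dimension :: "'a pair_pre_digraph \<Rightarrow> nat" where
  "metric_dimension \<Gamma> = (LEAST k. \<exists>W. finite W \<and> resolving_set \<Gamma> W \<and> card W = k)"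

definition divisor_count :: "nat \<Rightarrow> nat" where
  "divisor_count m = card {d. d dvd m}"

end

theory Submission
  imports Defs "HOL-Algebra.Multiplicative_Group"
begin

text \<open>
  An element outside \<open>\<langle>a\<rangle>\<close> generates every cyclic subgroup containing it, so all edges of the difference
  graph lie in \<open>\<langle>a\<rangle>\<close>, where two elements are adjacent iff their orders are incomparable divisors of
  \<open>m = 4n\<close>. Hence elements of the same order are twins, and a resolving set misses at most one element
  of each order \<open>d\<close> with \<open>1 < d < m\<close>. Conversely, missing exactly one element of each such order is
  enough as long as any two orders are told apart by their comparability to some order other than 2;
  order 2 is the only one attained by a single element, so after removing representatives no element of
  order 2 is left. The separation fails exactly for \<open>m = 2\<^sup>k p\<close>, where the orders \<open>p\<close> and \<open>2p\<close> are told
  apart only by the element of order 2, and this costs one more vertex.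
\<close>

section \<open>Distances in a simple graph\<close>

context pair_wf_digraph
begin

lemma graph_dist_eq_INF:
  "graph_dist G u v = (INF p\<in>{p. awalk u p v}. ereal (length p))"
proof -
  have "awalk_cost (\<lambda>_. 1) p = length p" for p
    by (induction p) simp_all
  then show ?thesis by (simp add: graph_dist_def \<mu>_def)
qed

lemma graph_dist_le: "awalk u p v \<Longrightarrow> graph_dist G u v \<le> length p"
  unfolding graph_dist_eq_INF by (rule INF_lower) simp

lemma le_graph_dist:
  assumes "\<And>p. awalk u p v \<Longrightarrow> k \<le> length p"
  shows "ereal (real k) \<le> graph_dist G u v"
  unfolding graph_dist_eq_INF using assms by (intro INF_greatest) simp

lemma graph_dist_self: "u \<in> pverts G \<Longrightarrow> graph_dist G u u = 0"
  using graph_dist_le[of u "[]" u] le_graph_dist[of u u 0]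
  by (simp add: awalk_Nil_iff zero_ereal_def)

lemma graph_dist_ge_1:
  assumes "u \<noteq> v"
  shows "1 \<le> graph_dist G u v"
proof -
  have "1 \<le> length p" if "awalk u p v" for p
    using that assms by (cases p) (auto simp: awalk_Nil_iff)
  from le_graph_dist[OF this] show ?thesis by (simp add: one_ereal_def)
qed

lemma graph_dist_arc:
  assumes "(u, v) \<in> parcs G" "u \<noteq> v"
  shows "graph_dist G u v = 1"
proof (rule antisym[OF _ graph_dist_ge_1[OF assms(2)]])
  have "awalk u [(u, v)] v"
    using assms in_arcsD2 by (auto simp: awalk_simps)
  from graph_dist_le[OF this] show "graph_dist G u v \<le> 1" by (simp add: one_ereal_def)
qed

lemma graph_dist_ge_2:
  assumes "u \<noteq> v" "(u, v) \<notin> parcs G"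
  shows "2 \<le> graph_dist G u v"
proof -
  have "2 \<le> length p" if "awalk u p v" for p
  proof (cases p)
    case Nil
    then show ?thesis using that assms by (auto simp: awalk_Nil_iff)
  next
    case (Cons e q)
    then show ?thesis using that assms by (cases q) (auto simp: awalk_simps)
  qed
  from le_graph_dist[OF this] show ?thesis by simp
qed

lemma graph_dist_eq_2:
  assumes "u \<noteq> v" "(u, v) \<notin> parcs G" "(u, w) \<in> parcs G" "(w, v) \<in> parcs G"
  shows "graph_dist G u v = 2"
proof (rule antisym[OF _ graph_dist_ge_2[OF assms(1,2)]])
  have "awalk u [(u, w), (w, v)] v"
    using assms in_arcsD2 by (auto simp: awalk_simps)
  from graph_dist_le[OF this] show "graph_dist G u v \<le> 2" by simp
qed

text \<open>A walk from \<open>u\<close> becomes a walk from \<open>v\<close> of the same length by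
  exchanging only its first arc; \<open>z \<noteq> u\<close> guarantees that there is a first
  arc.\<close>

lemma graph_dist_mono:
  assumes "\<And>w. (u, w) \<in> parcs G \<Longrightarrow> (v, w) \<in> parcs G" "z \<noteq> u"
  shows "graph_dist G v z \<le> graph_dist G u z"
  unfolding graph_dist_eq_INF[of u z]
proof (rule INF_greatest)
  fix p assume "p \<in> {p. awalk u p z}"
  then obtain w q where "p = (u, w) # q" "(u, w) \<in> parcs G" "awalk w q z"
    using assms(2) by (cases p) (auto simp: awalk_simps)
  then have "awalk v ((v, w) # q) z" "length ((v, w) # q) = length p"
    using assms(1) by (auto simp: awalk_simps)
  then show "graph_dist G v z \<le> ereal (length p)" by (metis graph_dist_le)
qed

lemma graph_dist_twins:
  assumes "\<And>w. (u, w) \<in> parcs G \<longleftrightarrow> (v, w) \<in> parcs G" "z \<noteq> u" "z \<noteq> v"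
  shows "graph_dist G u z = graph_dist G v z"
  using assms by (intro antisym graph_dist_mono) auto

end

lemma metric_dimension_eqI:
  assumes "finite W" "resolving_set \<Gamma> W" "card W = k"
    and "\<And>W. finite W \<Longrightarrow> resolving_set \<Gamma> W \<Longrightarrow> k \<le> card W"
  shows "metric_dimension \<Gamma> = k"
  unfolding metric_dimension_def using assms by (intro Least_equality) blast+

section \<open>Incomparable divisors\<close>

definition incomparable :: "nat \<Rightarrow> nat \<Rightarrow> bool" where
  "incomparable d e \<longleftrightarrow> \<not> d dvd e \<and> \<not> e dvd d"

lemma incomparable_sym: "incomparable d e \<longleftrightarrow> incomparable e d"
  by (auto simp: incomparable_def)

text \<open>These will be the orders of the vertices: 1 and \<open>m\<close> are comparable with
  every divisor of \<open>m\<close>, so elements of those orders are isolated.\<close>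

definition proper_divisors :: "nat \<Rightarrow> nat set" where
  "proper_divisors m = {d. d dvd m \<and> d \<noteq> 1 \<and> d \<noteq> m}"

lemma finite_proper_divisors: "m > 0 \<Longrightarrow> finite (proper_divisors m)"
  by (rule finite_subset[of _ "{d. d dvd m}"]) (auto simp: proper_divisors_def)

lemma card_proper_divisors:
  assumes "m > 1"
  shows "card (proper_divisors m) + 2 = divisor_count m"
proof -
  have "{d. d dvd m} = insert 1 (insert m (proper_divisors m))"
    by (auto simp: proper_divisors_def)
  moreover have "finite (proper_divisors m)" using assms by (simp add: finite_proper_divisors)
  moreover have "1 \<notin> insert m (proper_divisors m)" "m \<notin> proper_divisors m"
    using assms by (auto simp: proper_divisors_def)
  ultimately show ?thesis by (simp add: divisor_count_def)
qed

text \<open>\<open>M\<close> depends on \<open>m\<close> and \<open>p\<close> only, so two divisors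
  can be decomposed against the same \<open>M\<close>. Divisibility then splits into a comparison of
  the parts prime to \<open>p\<close> and a comparison of exponents.\<close>

lemma prime_power_decomposition:
  fixes m p d :: nat
  assumes "m > 0" "Factorial_Ring.prime p" "d dvd m"
  defines "M \<equiv> m div p ^ multiplicity p m"
  obtains D where "m = M * p ^ multiplicity p m" "d = D * p ^ multiplicity p d" "coprime p M"
    "D dvd M" "multiplicity p d \<le> multiplicity p m"
proof
  let ?D = "d div p ^ multiplicity p d"
  have d: "d \<noteq> 0" using assms by auto
  show m: "m = M * p ^ multiplicity p m" by (simp add: M_def multiplicity_dvd)
  show D: "d = ?D * p ^ multiplicity p d" by (simp add: multiplicity_dvd)
  have "\<not> p dvd M" "\<not> p dvd ?D"
    unfolding M_def using assms(1,2) d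
    by (intro multiplicity_decompose; auto simp: not_prime_unit)+
  then have cop: "coprime p M" "coprime p ?D" using assms(2) by (simp_all add: prime_imp_coprime)
  then show "coprime p M" by simp
  have "?D dvd M * p ^ multiplicity p m"
    using D m assms(3) by (metis dvd_mult_left dvd_trans)
  then show "?D dvd M"
    using cop(2) by (simp add: coprime_dvd_mult_left_iff coprime_commute)
  show "multiplicity p d \<le> multiplicity p m"
    using assms by (simp add: dvd_imp_multiplicity_le)
qed

text \<open>
  With \<open>M\<close> the part of \<open>m\<close> prime to \<open>p\<close>, the candidates for \<open>e\<close> are \<open>p\<^sup>\<alpha>\<close>, \<open>M p\<^sup>i\<close> and \<open>D p\<^sup>A\<close>,
  where \<open>d = D p\<^sup>i\<close> and \<open>d' = D' p\<^sup>\<alpha>\<close>; all of them fail only if \<open>p = 2\<close>, \<open>d = M\<close> and \<open>d' = 2 M\<close>.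
\<close>
lemma proper_divisors_separated_aux:
  fixes m p d d' :: nat
  assumes m: "m > 0" "4 dvd m" "\<And>p k. Factorial_Ring.prime p \<Longrightarrow> m \<noteq> p ^ k"
    and p: "Factorial_Ring.prime p" "multiplicity p d < multiplicity p d'"
    and d: "d \<in> proper_divisors m" and d': "d' \<in> proper_divisors m"
  shows "\<exists>e\<in>proper_divisors m. incomparable e d \<noteq> incomparable e d' \<and>
    (e = 2 \<longrightarrow> (\<exists>k q. k > 1 \<and> Factorial_Ring.prime q \<and> q \<noteq> 2 \<and> m = 2 ^ k * q))"
proof -
  define M A i \<alpha> where defs: "M = m div p ^ multiplicity p m" "A = multiplicity p m"
    "i = multiplicity p d" "\<alpha> = multiplicity p d'"
  have "d dvd m" "d' dvd m" using d d' by (simp_all add: proper_divisors_def)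
  obtain D where MA: "m = M * p ^ A" "coprime p M" and D: "d = D * p ^ i" "D dvd M"
    using prime_power_decomposition[OF m(1) p(1) \<open>d dvd m\<close>] unfolding defs by blast
  obtain D' where D': "d' = D' * p ^ \<alpha>" "D' dvd M" "\<alpha> \<le> A"
    using prime_power_decomposition[OF m(1) p(1) \<open>d' dvd m\<close>] unfolding defs by blast
  have i\<alpha>: "i < \<alpha>" using p defs by simp
  have p1: "p > 1" using p(1) by (rule prime_gt_1_nat)
  have M1: "M \<noteq> 1" using m(3)[OF p(1), of A] MA(1) by auto
  have M0: "M > 0" using m MA by (auto intro: Nat.gr0I)
  have D0: "D > 0" "D' > 0" using M0 D(2) D'(2) by (auto intro: Nat.gr0I)
  have cop: "coprime (p ^ j) E" if "E dvd M" for E j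
    using MA(2) that coprime_divisors[of p p E M] by simp
  have not_dvd: "\<not> E * p ^ j dvd F * p ^ l" if "F dvd M" "l < j" for E F j l
  proof
    assume "E * p ^ j dvd F * p ^ l"
    then have "p ^ j dvd F * p ^ l" by (rule dvd_mult_right)
    then have "p ^ j dvd p ^ l" using cop[OF that(1)] by (simp add: coprime_dvd_mult_right_iff)
    then show False using that(2) p1 by (simp add: dvd_power_iff_le)
  qed
  have dvd_iff: "E * p ^ j dvd F * p ^ l \<longleftrightarrow> E dvd F" if "E dvd M" "j \<le> l" for E F j l
  proof
    assume "E * p ^ j dvd F * p ^ l"
    then have "E dvd F * p ^ l" by (rule dvd_mult_left)
    then show "E dvd F"
      using cop[OF that(1)] by (simp add: coprime_dvd_mult_left_iff coprime_commute)
  next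
    assume "E dvd F"
    then show "E * p ^ j dvd F * p ^ l" using that by (simp add: le_imp_power_dvd mult_dvd_mono)
  qed
  have eq_iff: "E * p ^ j = m \<longleftrightarrow> E = M \<and> j = A" if "E dvd M" for E j
  proof
    assume eq: "E * p ^ j = m"
    have "\<not> j < A" using not_dvd[OF that, of j A M] eq MA by auto
    moreover have "\<not> A < j" using not_dvd[of M A j E] eq MA by auto
    ultimately have "j = A" by simp
    then show "E = M \<and> j = A" using eq MA(1) p1 by simp
  qed (simp add: MA)
  show ?thesis
  proof (cases "D = 1 \<or> p ^ \<alpha> = 2")
    case False
    \<comment> \<open>\<open>p ^ \<alpha>\<close> divides \<open>d'\<close>. It does not divide
      \<open>d\<close> because \<open>i < \<alpha>\<close>, and \<open>d\<close> does not divide it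
      because \<open>D \<noteq> 1\<close>.\<close>
    have "p ^ \<alpha> \<in> proper_divisors m"
      using eq_iff[of 1 \<alpha>] M1 MA(1) D'(3) p1 i\<alpha>
      by (auto simp: proper_divisors_def le_imp_power_dvd dvd_mult)
    moreover have "p ^ \<alpha> dvd d'" by (simp add: D')
    moreover have "\<not> p ^ \<alpha> dvd d" using not_dvd[of D i \<alpha> 1] D i\<alpha> by simp
    moreover have "\<not> d dvd p ^ \<alpha>" using dvd_iff[of D i \<alpha> 1] D i\<alpha> False by simp
    ultimately show ?thesis using False by (intro bexI[of _ "p ^ \<alpha>"]) (auto simp: incomparable_def)
  next
    case D1: True
    show ?thesis
    proof (cases "D' = M")
      case False
      \<comment> \<open>\<open>M * p ^ i\<close> is a multiple of \<open>d\<close>. It is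
        incomparable with \<open>d'\<close>, whose exponent of \<open>p\<close> is larger but whose
        part prime to \<open>p\<close> is a proper divisor of \<open>M\<close>.\<close>
      have "M * p ^ i \<in> proper_divisors m"
        using eq_iff[of M i] M1 MA(1) D'(3) p1 i\<alpha>
        by (auto simp: proper_divisors_def le_imp_power_dvd)
      moreover have "d dvd M * p ^ i" using D by simp
      moreover have "\<not> M * p ^ i dvd d'"
        using dvd_iff[of M i \<alpha> D'] D' i\<alpha> False by (auto dest: dvd_antisym)
      moreover have "\<not> d' dvd M * p ^ i" using not_dvd[of M i \<alpha> D'] D' i\<alpha> by simp
      moreover have "M * p ^ i \<noteq> 2"
      proof
        \<comment> \<open>Since \<open>M \<noteq> 1\<close>, this forces \<open>M = 2\<close> and
          \<open>p\<close> odd, so \<open>m\<close> would be divisible by 2 but not by 4.\<close>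
        assume e: "M * p ^ i = 2"
        then have "M dvd 2" by (metis dvd_triv_left)
        then have "M = 2" using M1 two_is_prime_nat prime_nat_iff by blast
        moreover have "odd p" using MA(2) \<open>M = 2\<close> by simp
        moreover have "4 dvd 2 * p ^ A \<longleftrightarrow> 2 dvd p ^ A" by presburger
        ultimately have "\<not> 4 dvd M * p ^ A" by simp
        then show False using m MA by simp
      qed
      ultimately show ?thesis by (intro bexI[of _ "M * p ^ i"]) (auto simp: incomparable_def)
    next
      case D'M: True
      have \<alpha>A: "\<alpha> < A" using D'M eq_iff[of M \<alpha>] d' D' by (auto simp: proper_divisors_def)
      show ?thesis
      proof (cases "D = M")
        case False
        have nd: "\<not> M dvd D" using False D(2) dvd_antisym by blast
        \<comment> \<open>\<open>D * p ^ A\<close> is a multiple of \<open>d\<close>; against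
          \<open>d' = M * p ^ \<alpha>\<close> it has the larger exponent and the smaller part prime
          to \<open>p\<close>. It is not 2 because \<open>i < \<alpha> < A\<close> makes
          \<open>A\<close> at least 2.\<close>
        have "D * p ^ A \<in> proper_divisors m"
          using eq_iff[of D A] False MA(1) \<alpha>A p1 D
          by (auto simp: proper_divisors_def)
        moreover have "d dvd D * p ^ A" using D dvd_iff[of D i A D] i\<alpha> \<alpha>A by simp
        moreover have "\<not> D * p ^ A dvd d'" using not_dvd[of M \<alpha> A D] \<alpha>A D' D'M by simp
        moreover have "\<not> d' dvd D * p ^ A" using dvd_iff[of M \<alpha> A D] \<alpha>A D' D'M nd by simp
        moreover have "D * p ^ A \<noteq> 2"
        proof
          assume e: "D * p ^ A = 2"
          have "A \<ge> 2" using \<alpha>A i\<alpha> by simp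
          then have "p ^ 2 \<le> p ^ A" using p1 by (simp add: power_increasing)
          moreover have "p ^ 2 \<ge> 2 ^ 2" using p1 by (intro power_mono) auto
          moreover have "D * p ^ A \<ge> p ^ A" using D0 by simp
          ultimately show False using e by simp
        qed
        ultimately show ?thesis by (intro bexI[of _ "D * p ^ A"]) (auto simp: incomparable_def)
      next
        case DM: True
        \<comment> \<open>Only \<open>d = M\<close> and \<open>d' = 2 * M\<close> with
          \<open>M\<close> odd remain.\<close>
        then have "p ^ \<alpha> = 2" using D1 M1 by simp
        moreover have "p dvd p ^ \<alpha>" using i\<alpha> by (simp add: dvd_power)
        ultimately have p: "p = 2" using p(1) by (simp add: primes_dvd_imp_eq)
        with \<open>p ^ \<alpha> = 2\<close> have "(2::nat) ^ \<alpha> = 2 ^ 1" by simp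
        then have "\<alpha> = 1" by (simp only: power_inject_exp one_less_numeral_iff semiring_norm)
        with p i\<alpha> have p2: "p = 2" "\<alpha> = 1" "i = 0" by simp_all
        have oddM: "odd M" using MA p2 by simp
        have dd: "d = M" "d' = 2 * M" using D D' p2 D'M DM by simp_all
        show ?thesis
        proof (cases "\<exists>f. f dvd M \<and> f \<noteq> 1 \<and> f \<noteq> M")
          case True
          then obtain f where f: "f dvd M" "f \<noteq> 1" "f \<noteq> M" by blast
          \<comment> \<open>For a nontrivial divisor \<open>f\<close> of the odd number
            \<open>M\<close>, \<open>2 * f\<close> divides \<open>2 * M\<close> and is incomparable
            with \<open>M\<close>.\<close>
          have "f * p ^ 1 \<in> proper_divisors m"
            using eq_iff[of f 1] f MA(1) \<alpha>A dvd_iff[of f 1 A M] p2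
            by (auto simp: proper_divisors_def)
          moreover have "\<not> f * 2 dvd M" using oddM by (auto dest: dvd_mult_right)
          moreover have "\<not> M dvd f * 2"
            using oddM f by (metis coprime_dvd_mult_left_iff coprime_right_2_iff_odd dvd_antisym)
          ultimately show ?thesis using f(1,2) p2
            by (intro bexI[of _ "f * 2"]) (auto simp: incomparable_def dd mult.commute)
        next
          case False
          \<comment> \<open>Here \<open>M\<close> is an odd prime, so \<open>m = 2 ^ A * M\<close>
            has the exceptional form and the choice \<open>e = 2\<close> is allowed.\<close>
          then have "Factorial_Ring.prime M" using M1 M0 unfolding prime_nat_iff by auto
          moreover have "\<not> M dvd 2" using oddM M1 two_is_prime_nat unfolding prime_nat_iff by auto
          then have "2 \<in> proper_divisors m" "incomparable 2 d" "\<not> incomparable 2 d'"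
            using MA p2 \<alpha>A m oddM M1 by (auto simp: proper_divisors_def incomparable_def dd)
          moreover have "M \<noteq> 2" using oddM by auto
          ultimately show ?thesis using MA(1) p2 \<alpha>A by (intro bexI[of _ 2]) (auto simp: mult.commute)
        qed
      qed
    qed
  qed
qed

text \<open>Distinct numbers differ in the multiplicity of some prime, and the claim is symmetric in
  \<open>d\<close> and \<open>d'\<close>.\<close>

lemma proper_divisors_separated:
  fixes m d d' :: nat
  assumes m: "m > 0" "4 dvd m" "\<And>p k. Factorial_Ring.prime p \<Longrightarrow> m \<noteq> p ^ k"
    and d: "d \<in> proper_divisors m" and d': "d' \<in> proper_divisors m" and "d \<noteq> d'"
  shows "\<exists>e\<in>proper_divisors m. incomparable e d \<noteq> incomparable e d' \<and>
    (e = 2 \<longrightarrow> (\<exists>k q. k > 1 \<and> Factorial_Ring.prime q \<and> q \<noteq> 2 \<and> m = 2 ^ k * q))"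
proof -
  have "d \<noteq> 0" "d' \<noteq> 0" using d d' m(1) by (auto simp: proper_divisors_def intro: Nat.gr0I)
  then obtain p where "Factorial_Ring.prime p" "multiplicity p d \<noteq> multiplicity p d'"
    using \<open>d \<noteq> d'\<close> by (metis multiplicity_eq_nat neq0_conv)
  then consider "multiplicity p d < multiplicity p d'" | "multiplicity p d' < multiplicity p d"
    by linarith
  then show ?thesis
  proof cases
    case 1
    from proper_divisors_separated_aux[OF m \<open>Factorial_Ring.prime p\<close> 1 d d'] show ?thesis .
  next
    case 2
    from proper_divisors_separated_aux[OF m \<open>Factorial_Ring.prime p\<close> 2 d' d] show ?thesis by blast
  qed
qed

section \<open>Graphs of incomparable divisors\<close>

text \<open>The difference graph with the group forgotten: \<open>c\<close> stands for the order of
  an element and \<open>m\<close> for the order of the cyclic group. \<open>another\<close> and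
  \<open>unique\<close> record that 2 is the only colour carried by a single vertex.\<close>

locale divisor_colored_graph = pair_wf_digraph +
  fixes c :: "'a \<Rightarrow> nat" and m :: nat
  assumes finite_verts: "finite (pverts G)"
    and arcs_iff: "\<And>x y. (x, y) \<in> parcs G \<longleftrightarrow>
      x \<in> pverts G \<and> y \<in> pverts G \<and> incomparable (c x) (c y)"
    and colors: "c ` pverts G = proper_divisors m"
    and another: "\<And>x. x \<in> pverts G \<Longrightarrow> c x \<noteq> 2 \<Longrightarrow> \<exists>y\<in>pverts G. y \<noteq> x \<and> c y = c x"
    and unique: "\<And>x y. x \<in> pverts G \<Longrightarrow> y \<in> pverts G \<Longrightarrow> c x = 2 \<Longrightarrow> c y = 2 \<Longrightarrow> x = y"
    and m_pos: "m > 0" and four_dvd: "4 dvd m"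
    and not_prime_power: "\<And>p k. Factorial_Ring.prime p \<Longrightarrow> m \<noteq> p ^ k"
begin

lemma color_proper: "x \<in> pverts G \<Longrightarrow> c x \<in> proper_divisors m"
  using colors by blast

lemma no_loop: "(x, x) \<notin> parcs G"
  by (simp add: arcs_iff incomparable_def)

lemma graph_dist_eq_0_iff:
  assumes "u \<in> pverts G"
  shows "graph_dist G u v = 0 \<longleftrightarrow> u = v"
  using graph_dist_self[OF assms] graph_dist_ge_1[of u v] by (cases "u = v") auto

lemma graph_dist_eq_1_iff:
  assumes "u \<in> pverts G"
  shows "graph_dist G u v = 1 \<longleftrightarrow> (u, v) \<in> parcs G"
proof (cases "u = v")
  case True
  then show ?thesis using assms graph_dist_self no_loop by auto
next
  case False
  then show ?thesis using graph_dist_arc[of u v] graph_dist_ge_2[of u v] by (cases "(u, v) \<in> parcs G") auto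
qed

text \<open>Vertices of equal colour are twins, so only the two themselves can tell them
  apart.\<close>

lemma inj_on_color_complement:
  assumes "resolving_set G W"
  shows "inj_on c (pverts G - W)"
proof (rule inj_onI, rule ccontr)
  fix u v assume u: "u \<in> pverts G - W" and v: "v \<in> pverts G - W" and eq: "c u = c v" and "u \<noteq> v"
  then obtain z where "z \<in> W" "graph_dist G u z \<noteq> graph_dist G v z"
    using assms unfolding resolving_set_def by blast
  moreover have "graph_dist G u z = graph_dist G v z"
    by (rule graph_dist_twins) (use u v eq \<open>z \<in> W\<close> in \<open>auto simp: arcs_iff\<close>)
  ultimately show False by simp
qed

text \<open>A colour separating \<open>c u\<close> from \<open>c v\<close> must occur in
  \<open>W\<close>. Any colour other than 2 does, being carried by two vertices of which at most one
  is missing; colour 2 is required only for the exceptional \<open>m\<close>, which is what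
  \<open>two\<close> provides.\<close>

lemma resolving_setI:
  assumes "W \<subseteq> pverts G" "inj_on c (pverts G - W)"
    and two: "\<And>k q x. k > 1 \<Longrightarrow> Factorial_Ring.prime q \<Longrightarrow> q \<noteq> 2 \<Longrightarrow> m = 2 ^ k * q \<Longrightarrow>
      x \<in> pverts G \<Longrightarrow> c x = 2 \<Longrightarrow> x \<in> W"
  shows "resolving_set G W"
  unfolding resolving_set_def
proof (intro conjI ballI impI)
  fix u v assume u: "u \<in> pverts G" and v: "v \<in> pverts G" and "u \<noteq> v"
  show "\<exists>z\<in>W. graph_dist G u z \<noteq> graph_dist G v z"
  proof (cases "u \<in> W \<or> v \<in> W")
    case True
    then show ?thesis
      using graph_dist_eq_0_iff[OF u] graph_dist_eq_0_iff[OF v] \<open>u \<noteq> v\<close> by metis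
  next
    case False
    then have "c u \<noteq> c v" using assms(2) u v \<open>u \<noteq> v\<close> by (auto dest: inj_onD)
    from proper_divisors_separated[OF m_pos four_dvd not_prime_power
        color_proper[OF u] color_proper[OF v] this]
    obtain e where e: "e \<in> proper_divisors m" "incomparable e (c u) \<noteq> incomparable e (c v)"
      and e2: "e = 2 \<Longrightarrow> \<exists>k q. k > 1 \<and> Factorial_Ring.prime q \<and> q \<noteq> 2 \<and> m = 2 ^ k * q"
      by blast
    obtain z where z: "z \<in> W" "c z = e"
    proof -
      have "e \<in> c ` pverts G" using e(1) colors by simp
      then obtain x where x: "x \<in> pverts G" "c x = e" by blast
      show thesis
      proof (cases "e = 2")
        case True
        then show ?thesis using that e2 two x by blast
      next
        case False
        then obtain y where "y \<in> pverts G" "y \<noteq> x" "c y = e" using another x by blast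
        then show ?thesis using that x assms(2) inj_onD[OF assms(2), of x y] by blast
      qed
    qed
    \<comment> \<open>Exactly one of \<open>u\<close> and \<open>v\<close> is at distance 1 from
      \<open>z\<close>.\<close>
    then have "(u, z) \<in> parcs G \<longleftrightarrow> (v, z) \<notin> parcs G"
      using e(2) u v assms(1) by (auto simp: arcs_iff incomparable_sym)
    then show ?thesis
      using z graph_dist_eq_1_iff[OF u] graph_dist_eq_1_iff[OF v] by metis
  qed
qed (use assms in auto)

section \<open>Sizes of resolving sets, counted through the colours they miss\<close>

lemma card_resolving_set:
  assumes "resolving_set G W"
  shows "card W + card (c ` (pverts G - W)) = card (pverts G)"
proof -
  have "W \<subseteq> pverts G" using assms by (simp add: resolving_set_def)
  then show ?thesis
    using card_image[OF inj_on_color_complement[OF assms]] finite_verts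
    by (simp add: card_Diff_subset finite_subset card_mono)
qed

lemma card_resolving_set_ge:
  assumes "resolving_set G W"
  shows "card (pverts G) \<le> card W + card (proper_divisors m)"
proof -
  have "card (c ` (pverts G - W)) \<le> card (c ` pverts G)"
    using finite_verts by (intro card_mono) auto
  then show ?thesis using card_resolving_set[OF assms] colors by simp
qed

lemma transversal:
  obtains T where "T \<subseteq> pverts G" "inj_on c T" "c ` T = proper_divisors m"
  using colors subset_image_inj[of "proper_divisors m" c "pverts G"] by auto

lemma metric_dimension_generic:
  assumes "\<not> (\<exists>k q. k > 1 \<and> Factorial_Ring.prime q \<and> q \<noteq> 2 \<and> m = 2 ^ k * q)"
  shows "metric_dimension G + card (proper_divisors m) = card (pverts G)"
proof -
  obtain T where T: "T \<subseteq> pverts G" "inj_on c T" "c ` T = proper_divisors m"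
    by (rule transversal)
  have compl: "pverts G - (pverts G - T) = T" using T(1) by blast
  have "resolving_set G (pverts G - T)"
    using T assms by (intro resolving_setI) (auto simp: compl)
  moreover from card_resolving_set[OF this]
  have card: "card (pverts G - T) + card (proper_divisors m) = card (pverts G)"
    by (simp add: compl T)
  moreover have "card (pverts G - T) \<le> card W" if "resolving_set G W" for W
    using card_resolving_set_ge[OF that] card by simp
  ultimately have "metric_dimension G = card (pverts G - T)"
    using finite_verts by (intro metric_dimension_eqI) auto
  then show ?thesis using card by simp
qed

text \<open>If every colour were missed, a vertex of colour \<open>q\<close> and one of colour
  \<open>2 * q\<close> would have equal distances to all of \<open>W\<close>. Missing every colour
  but 2 is possible.\<close>

lemma metric_dimension_special:
  fixes k q :: nat
  assumes kq: "k > 1" "Factorial_Ring.prime q" "q \<noteq> 2" "m = 2 ^ k * q"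
  shows "metric_dimension G + card (proper_divisors m) = card (pverts G) + 1"
proof -
  have q: "odd q" "q > 2" using kq(2,3) prime_odd_nat[of q] prime_ge_2_nat[of q] by auto
  obtain j where k: "k = Suc (Suc j)" using less_imp_Suc_add[OF kq(1)] by auto
  have "2 dvd m" "m \<noteq> 2" using q by (simp_all add: kq(4) k)
  then have two: "2 \<in> proper_divisors m" by (simp add: proper_divisors_def)
  have fin: "finite (proper_divisors m)" using finite_proper_divisors m_pos by blast
  \<comment> \<open>Away from 2, the colours \<open>q\<close> and \<open>2 * q\<close> have the same
    neighbours. Colour \<open>2 ^ k\<close> is adjacent to exactly the remaining ones and will
    supply midpoints for paths of length 2.\<close>
  have incomp_q: "incomparable e q \<longleftrightarrow> \<not> q dvd e"
    and incomp_2q: "incomparable e (2 * q) \<longleftrightarrow> \<not> q dvd e"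
    and incomp_2k: "incomparable e (2 ^ k) \<longleftrightarrow> q dvd e"
    if e: "e \<in> proper_divisors m" "e \<noteq> 2" for e
  proof -
    have "e dvd 2 ^ k * q" "e \<noteq> 1" "e \<noteq> 2 ^ k * q" using e kq by (auto simp: proper_divisors_def)
    have dvd_case: "incomparable e q \<longleftrightarrow> \<not> q dvd e" "incomparable e (2 * q) \<longleftrightarrow> \<not> q dvd e"
      "incomparable e (2 ^ k) \<longleftrightarrow> q dvd e"
      if qe: "q dvd e"
    proof -
      obtain f where f: "e = q * f" using qe by blast
      then have "f dvd 2 ^ k" using \<open>e dvd 2 ^ k * q\<close> q by (simp add: mult.commute)
      then obtain i where i: "f = 2 ^ i" "i \<le> k" using divides_primepow_nat two_is_prime_nat by blast
      \<comment> \<open>Now \<open>e = q * 2 ^ i\<close>: it is \<open>q\<close> itself for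
        \<open>i = 0\<close> and a multiple of \<open>2 * q\<close> otherwise.\<close>
      then have "i < k" using f \<open>e \<noteq> 2 ^ k * q\<close> by (cases "i = k") auto
      have "q dvd e" "e dvd 2 * q \<or> 2 * q dvd e" using f i by (cases i; simp)+
      then show "incomparable e q \<longleftrightarrow> \<not> q dvd e" "incomparable e (2 * q) \<longleftrightarrow> \<not> q dvd e"
        using qe by (auto simp: incomparable_def)
      have "\<not> q dvd 2 ^ k" using q kq by (metis prime_dvd_power primes_dvd_imp_eq two_is_prime_nat)
      moreover have "\<not> 2 ^ k dvd e"
      proof
        assume "2 ^ k dvd e"
        moreover have "coprime (2 ^ k) q" using q by simp
        ultimately have "2 ^ k dvd (2::nat) ^ i" using f i by (simp add: coprime_dvd_mult_right_iff)
        then show False using \<open>i < k\<close> by (simp add: dvd_power_iff_le)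
      qed
      ultimately show "incomparable e (2 ^ k) \<longleftrightarrow> q dvd e"
        using qe by (auto simp: incomparable_def dest: dvd_trans)
    qed
    have ndvd_case: "incomparable e q \<longleftrightarrow> \<not> q dvd e" "incomparable e (2 * q) \<longleftrightarrow> \<not> q dvd e"
      "incomparable e (2 ^ k) \<longleftrightarrow> q dvd e"
      if qe: "\<not> q dvd e"
    proof -
      have "coprime e q" using qe kq(2) by (simp add: prime_imp_coprime coprime_commute[of e])
      then have ek: "e dvd 2 ^ k" using \<open>e dvd 2 ^ k * q\<close> by (simp add: coprime_dvd_mult_left_iff)
      then obtain i where i: "e = 2 ^ i" "i \<le> k" using divides_primepow_nat two_is_prime_nat by blast
      \<comment> \<open>As \<open>e\<close> is neither 1 nor 2, it is divisible by 4 and cannot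
        divide \<open>2 * q\<close>.\<close>
      then obtain l where l: "i = Suc (Suc l)"
        using \<open>e \<noteq> 1\<close> e(2) by (metis not0_implies_Suc power_0 power_one_right One_nat_def)
      have "\<not> e dvd q" "\<not> e dvd 2 * q" using i l q by (auto dest: dvd_mult_left)
      then show "incomparable e q \<longleftrightarrow> \<not> q dvd e" "incomparable e (2 * q) \<longleftrightarrow> \<not> q dvd e"
        "incomparable e (2 ^ k) \<longleftrightarrow> q dvd e"
        using qe ek by (auto simp: incomparable_def dest: dvd_mult_right)
    qed
    show "incomparable e q \<longleftrightarrow> \<not> q dvd e" "incomparable e (2 * q) \<longleftrightarrow> \<not> q dvd e"
      "incomparable e (2 ^ k) \<longleftrightarrow> q dvd e"
      using dvd_case ndvd_case by blast+
  qed
  have lower: "card (pverts G) + 1 \<le> card W + card (proper_divisors m)" if W: "resolving_set G W" for W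
  proof (rule ccontr)
    assume "\<not> ?thesis"
    then have "card (c ` (pverts G - W)) \<ge> card (proper_divisors m)"
      using card_resolving_set[OF W] by simp
    moreover have "c ` (pverts G - W) \<subseteq> proper_divisors m" using colors by blast
    ultimately have "c ` (pverts G - W) = proper_divisors m" using fin by (intro card_seteq)
    then have color_preimage: "\<exists>x. x \<in> pverts G - W \<and> c x = d" if "d \<in> proper_divisors m" for d
      using that by (metis imageE)
    have color_preimage': "\<exists>x. x \<in> pverts G \<and> c x = d" if "d \<in> proper_divisors m" for d
      using that color_preimage by blast
    have "q \<in> proper_divisors m" "2 * q \<in> proper_divisors m" "2 ^ k \<in> proper_divisors m"
      using kq q k by (auto simp: proper_divisors_def)
    then obtain x u v w where x: "x \<in> pverts G - W" "c x = 2" and u: "u \<in> pverts G - W" "c u = q"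
      and v: "v \<in> pverts G - W" "c v = 2 * q" and w: "w \<in> pverts G" "c w = 2 ^ k"
      using two color_preimage color_preimage' by meson
    have "u \<noteq> v" using u v q by auto
    have "graph_dist G u z = graph_dist G v z" if z: "z \<in> W" for z
    proof -
      have zG: "z \<in> pverts G" using z W by (auto simp: resolving_set_def)
      \<comment> \<open>The only vertex of colour 2 is \<open>x\<close>, which lies outside
        \<open>W\<close>.\<close>
      have "c z \<noteq> 2" using unique[of z x] x z zG by auto
      note cz = color_proper[OF zG] this
      have ne: "u \<noteq> z" "v \<noteq> z" using u v z by auto
      show ?thesis
      proof (cases "q dvd c z")
        case False
        then have "(u, z) \<in> parcs G" "(v, z) \<in> parcs G"
          using u v zG incomp_q[OF cz] incomp_2q[OF cz] by (auto simp: arcs_iff incomparable_sym)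
        then show ?thesis using ne graph_dist_arc by metis
      next
        case True
        then have "(u, z) \<notin> parcs G" "(v, z) \<notin> parcs G" "(w, z) \<in> parcs G"
          using u v w zG incomp_q[OF cz] incomp_2q[OF cz] incomp_2k[OF cz]
          by (auto simp: arcs_iff incomparable_sym)
        \<comment> \<open>\<open>w\<close> is a common neighbour of \<open>u\<close>,
          \<open>v\<close> and \<open>z\<close>, so both distances to \<open>z\<close> are
          2.\<close>
        moreover have "(u, w) \<in> parcs G" "(v, w) \<in> parcs G"
          using u v w incomp_2k[of q] incomp_2k[of "2 * q"] color_proper[of u] color_proper[of v] q
          by (auto simp: arcs_iff)
        ultimately show ?thesis using ne graph_dist_eq_2 by metis
      qed
    qed
    then show False using W u v \<open>u \<noteq> v\<close> unfolding resolving_set_def by blast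
  qed
  obtain T where T: "T \<subseteq> pverts G" "inj_on c T" "c ` T = proper_divisors m"
    by (rule transversal)
  define S where "S = {x \<in> T. c x \<noteq> 2}"
  have compl: "pverts G - (pverts G - S) = S" using T(1) by (auto simp: S_def)
  have "inj_on c S" using T(2) by (auto simp: S_def inj_on_def)
  have res: "resolving_set G (pverts G - S)"
  proof (rule resolving_setI)
    show "inj_on c (pverts G - (pverts G - S))" using \<open>inj_on c S\<close> by (simp only: compl)
  qed (auto simp: S_def)
  have "c ` S = proper_divisors m - {2}" using T(3) by (auto simp: S_def)
  then have "card (c ` S) + 1 = card (proper_divisors m)"
    using two fin by (metis card_Suc_Diff1 Suc_eq_plus1)
  then have card: "card (pverts G - S) + card (proper_divisors m) = card (pverts G) + 1"
    using card_resolving_set[OF res] by (simp add: compl)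
  have "card (pverts G - S) \<le> card W" if "resolving_set G W" for W
    using lower[OF that] card by simp
  then have "metric_dimension G = card (pverts G - S)"
    using finite_verts res by (intro metric_dimension_eqI) auto
  then show ?thesis using card by simp
qed

end

section \<open>Cyclic subgroups and the difference graph\<close>

text \<open>This is what keeps vertices of these orders from being isolated. For a prime
  \<open>p\<close> whose exponent in \<open>d\<close> is not maximal, the full power of
  \<open>p\<close> in \<open>m\<close> is incomparable with \<open>d\<close>, unless
  \<open>d\<close> is itself a power of \<open>p\<close>; then the part of \<open>m\<close> prime to
  \<open>p\<close> is.\<close>

lemma incomparable_exists:
  fixes m d :: nat
  assumes m: "m > 0" "\<And>p k. Factorial_Ring.prime p \<Longrightarrow> m \<noteq> p ^ k" and d: "d \<in> proper_divisors m"
  shows "\<exists>e\<in>proper_divisors m. incomparable d e"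
proof -
  have dm: "d dvd m" "d \<noteq> m" "d \<noteq> 1" using d by (simp_all add: proper_divisors_def)
  then have "d \<noteq> 0" using m(1) by auto
  then obtain p where p: "Factorial_Ring.prime p" "multiplicity p d \<noteq> multiplicity p m"
    using dm m(1) by (metis multiplicity_eq_nat neq0_conv)
  define M A i where defs: "M = m div p ^ multiplicity p m" "A = multiplicity p m" "i = multiplicity p d"
  obtain D where MA: "m = M * p ^ A" "coprime p M" and D: "d = D * p ^ i" "D dvd M" and "i \<le> A"
    using prime_power_decomposition[OF m(1) p(1) dm(1)] unfolding defs by blast
  have iA: "i < A" using p(2) \<open>i \<le> A\<close> defs by simp
  have p1: "p > 1" using p(1) by (rule prime_gt_1_nat)
  have M1: "M \<noteq> 1" using m(2)[OF p(1), of A] MA(1) by auto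
  have M0: "M > 0" using m MA by (auto intro: Nat.gr0I)
  have cop: "coprime p D" using MA(2) D(2) coprime_divisors[of p p D M] by simp
  show ?thesis
  proof (cases "D = 1")
    case False
    have "\<not> p ^ A dvd D * p ^ i"
    proof
      assume "p ^ A dvd D * p ^ i"
      then have "p ^ A dvd p ^ i" using cop by (simp add: coprime_dvd_mult_right_iff)
      then show False using iA p1 by (simp add: dvd_power_iff_le)
    qed
    moreover have "\<not> D * p ^ i dvd p ^ A"
    proof
      assume "D * p ^ i dvd p ^ A"
      then have "D dvd p ^ A" by (rule dvd_mult_left)
      moreover have "coprime D (p ^ A)" using cop by (simp add: coprime_commute)
      ultimately show False using False by (metis coprime_absorb_left nat_dvd_1_iff_1)
    qed
    moreover have "p ^ A \<in> proper_divisors m"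
      using MA(1) M1 iA p1 by (auto simp: proper_divisors_def)
    ultimately show ?thesis by (intro bexI[of _ "p ^ A"]) (auto simp: incomparable_def D)
  next
    case True
    then have "i > 0" using dm D by (auto intro: Nat.gr0I)
    have "\<not> M dvd p ^ i"
    proof
      assume "M dvd p ^ i"
      moreover have "coprime M (p ^ i)" using MA(2) by (simp add: coprime_commute)
      ultimately show False using M1 by (metis coprime_absorb_left nat_dvd_1_iff_1)
    qed
    moreover have "\<not> p ^ i dvd M"
    proof
      assume "p ^ i dvd M"
      moreover have "p dvd p ^ i" using \<open>i > 0\<close> by (simp add: dvd_power)
      ultimately have "p dvd M" by (metis dvd_trans)
      then show False using MA(2) p1 by (simp add: coprime_absorb_left)
    qed
    moreover have "p ^ A > 1" using one_less_power[OF p1] iA by simp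
    then have "M \<in> proper_divisors m"
      using MA(1) M1 M0 by (auto simp: proper_divisors_def)
    ultimately show ?thesis by (intro bexI[of _ M]) (auto simp: incomparable_def D True)
  qed
qed

section \<open>Orders and powers in a finite cyclic subgroup\<close>

context group
begin

lemma pow_cong_ord:
  assumes "x \<in> carrier G" "[i = j] (mod ord x)"
  shows "x [^] (i::nat) = x [^] j"
proof -
  have "int (ord x) dvd int j - int i" using assms(2) by (simp add: cong_sym cong_int_iff cong_iff_dvd_diff[symmetric])
  then show ?thesis using int_pow_eq[OF assms(1), of "int i" "int j"] by (simp add: int_pow_int)
qed

text \<open>The exponents run from 1 to \<open>ord a\<close> instead of starting at 0: this range
  contains \<open>totatives (ord a)\<close> and keeps exponents positive, as the gcd formula for the
  order of a power requires.\<close>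

lemma generate_eq_image_pow:
  assumes "a \<in> carrier G" "ord a \<noteq> 0"
  shows "generate G {a} = (\<lambda>i. a [^] i) ` {0<..ord a}"
proof -
  have "a [^] k \<in> (\<lambda>i. a [^] i) ` {0<..ord a}" for k :: nat
  proof (cases "k mod ord a = 0")
    case True
    then have "a [^] k = a [^] ord a" using assms by (intro pow_cong_ord) (auto simp: cong_def)
    then show ?thesis using assms(2) by (intro image_eqI[where x = "ord a"]) auto
  next
    case False
    have "a [^] k = a [^] (k mod ord a)" using assms by (intro pow_cong_ord) (auto simp: cong_def)
    then show ?thesis using assms False by (auto intro!: imageI less_imp_le)
  qed
  then show ?thesis unfolding generate_pow_nat[OF assms] by auto
qed

lemma ord_dvd_of_mem_generate:
  assumes "y \<in> carrier G" "x \<in> generate G {y}"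
  shows "ord x dvd ord y"
proof -
  obtain k :: int where k: "x = y [^] k" using assms generate_pow by blast
  then have "x [^] int (ord y) = (y [^] int (ord y)) [^] k"
    using assms(1) by (simp add: int_pow_pow mult.commute)
  then have "x [^] ord y = \<one>"
    using assms(1) by (simp add: int_pow_int int_pow_one)
  then show ?thesis using k assms(1) by (simp add: pow_eq_id)
qed

text \<open>A finite cyclic group has one subgroup per order. For \<open>x = a [^] i\<close> and
  \<open>y = a [^] j\<close>, divisibility of the orders gives that \<open>gcd j (ord a)\<close>
  divides \<open>i\<close>, and Bezout then solves for an exponent taking \<open>y\<close> to
  \<open>x\<close>.\<close>

lemma mem_generate_iff_ord_dvd:
  assumes a: "a \<in> carrier G" "ord a \<noteq> 0" and x: "x \<in> generate G {a}" and y: "y \<in> generate G {a}"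
  shows "x \<in> generate G {y} \<longleftrightarrow> ord x dvd ord y"
proof
  assume "ord x dvd ord y"
  have "\<exists>i. z = a [^] i \<and> i > (0::nat)" if "z \<in> generate G {a}" for z
    using that generate_eq_image_pow[OF a] by auto
  then obtain i j :: nat where i: "x = a [^] i" "i > 0" and j: "y = a [^] j" "j > 0"
    using x y by meson
  let ?m = "ord a"
  have ords: "ord x = ?m div gcd ?m i" "ord y = ?m div gcd ?m j"
    using i j ord_pow_gen[OF a(1)] by simp_all
  then obtain w where w: "?m div gcd ?m j = (?m div gcd ?m i) * w" using \<open>ord x dvd ord y\<close> by auto
  have "gcd ?m j * w * (?m div gcd ?m i) = gcd ?m j * (?m div gcd ?m j)"
    unfolding w by (simp only: ac_simps)
  also have "\<dots> = gcd ?m i * (?m div gcd ?m i)" by simp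
  finally have "gcd ?m j * w * (?m div gcd ?m i) = gcd ?m i * (?m div gcd ?m i)" .
  moreover have "?m div gcd ?m i \<noteq> 0" using a(2) gcd_le1_nat[of ?m i] by (simp add: div_eq_0_iff not_less)
  ultimately have "gcd ?m i = gcd ?m j * w" by (simp only: mult_cancel2 simp_thms)
  then have "gcd ?m j dvd gcd ?m i" by simp
  then have "gcd j ?m dvd i" by (simp add: gcd.commute)
  then obtain t where t: "i = gcd j ?m * t" by (rule dvdE)
  obtain k where "[j * k = gcd j ?m] (mod ?m)" using cong_solve_nat j(2) by blast
  from cong_scalar_right[OF this, of t] have "[j * k * t = i] (mod ?m)" by (simp only: t[symmetric])
  from pow_cong_ord[OF a(1) this] have "x = a [^] (j * k * t)" using i by simp
  then have "x = y [^] (k * t)" using j a(1) by (simp add: nat_pow_pow mult.assoc)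
  then have "x = y [^] int (k * t)" by (simp only: int_pow_int)
  moreover have "y \<in> carrier G" using j a by simp
  ultimately show "x \<in> generate G {y}" using generate_pow by blast
next
  assume "x \<in> generate G {y}"
  moreover have "y \<in> carrier G" using y a generate_in_carrier[of "{a}" y] by auto
  ultimately show "ord x dvd ord y" by (rule ord_dvd_of_mem_generate[rotated])
qed

lemma cyclic_subgroup_eq_generate:
  assumes "subgroup C G" "cyclic_group (G\<lparr>carrier := C\<rparr>)"
  obtains c where "c \<in> C" "C = generate G {c}"
proof -
  obtain c where c: "c \<in> C" and eq: "subgroup_generated (G\<lparr>carrier := C\<rparr>) {c} = G\<lparr>carrier := C\<rparr>"
    using assms(2) by (auto simp: cyclic_group_def)
  have "C = generate (G\<lparr>carrier := C\<rparr>) {c}"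
    using arg_cong[OF eq, of carrier] c by (simp add: carrier_subgroup_generated)
  also have "\<dots> = generate G {c}" using c assms(1) by (intro generate_consistent) auto
  finally show ?thesis using that c by blast
qed

text \<open>If \<open>x\<close> and \<open>y\<close> lie in a cyclic subgroup generated by
  \<open>c\<close> and \<open>x\<close> is outside \<open>\<langle>a\<rangle>\<close>, then
  \<open>outside\<close> puts \<open>c\<close>, hence \<open>y\<close>, into the subgroup generated
  by \<open>x\<close>. The edge then belongs to the power graph and is removed.\<close>

lemma parcs_difference_graph:
  assumes a: "a \<in> carrier G" "ord a \<noteq> 0"
    and outside: "\<And>x c. x \<in> carrier G \<Longrightarrow> c \<in> carrier G \<Longrightarrow> x \<notin> generate G {a} \<Longrightarrow>
      x \<in> generate G {c} \<Longrightarrow> c \<in> generate G {x}"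
  shows "parcs (difference_graph G) =
    {(x, y). x \<in> generate G {a} \<and> y \<in> generate G {a} \<and> incomparable (ord x) (ord y)}" (is "_ = ?R")
proof (intro equalityI subrelI)
  fix x y assume "(x, y) \<in> ?R"
  then have x: "x \<in> generate G {a}" and y: "y \<in> generate G {a}" and inc: "incomparable (ord x) (ord y)"
    by auto
  then have "x \<notin> generate G {y}" "y \<notin> generate G {x}" "x \<noteq> y"
    using mem_generate_iff_ord_dvd[OF a] by (auto simp: incomparable_def)
  moreover have "x \<in> carrier G" "y \<in> carrier G" using x y a generate_in_carrier[of "{a}"] by auto
  moreover have "subgroup (generate G {a}) G" using a by (intro generate_is_subgroup) auto
  moreover have "cyclic_group (G\<lparr>carrier := generate G {a}\<rparr>)"
    using cyclic_group_generated[of a] a by (simp add: subgroup_generated_def)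
  ultimately show "(x, y) \<in> parcs (difference_graph G)"
    using x y by (auto simp: difference_graph_def delete_isolated_def remove_edges_def
        power_graph_def enhanced_power_graph_def)
next
  fix x y assume "(x, y) \<in> parcs (difference_graph G)"
  then obtain C where xy: "x \<in> carrier G" "y \<in> carrier G"
    and C: "subgroup C G" "cyclic_group (G\<lparr>carrier := C\<rparr>)" "x \<in> C" "y \<in> C"
    and ndvd: "x \<notin> generate G {y}" "y \<notin> generate G {x}"
    by (auto simp: difference_graph_def delete_isolated_def remove_edges_def
        power_graph_def enhanced_power_graph_def)
  obtain c where c: "c \<in> C" "C = generate G {c}" using cyclic_subgroup_eq_generate[OF C(1,2)] .
  have cG: "c \<in> carrier G" by (rule subgroup.mem_carrier[OF C(1) c(1)])
  have sub: "C \<subseteq> generate G {z}" if "c \<in> generate G {z}" "z \<in> carrier G" for z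
    unfolding c(2) using that by (intro generate_subgroup_incl generate_is_subgroup) auto
  have "x \<in> generate G {a}"
    using outside[OF xy(1) cG] sub[OF _ xy(1)] C(3,4) c(2) ndvd by blast
  moreover have "y \<in> generate G {a}"
    using outside[OF xy(2) cG] sub[OF _ xy(2)] C(3,4) c(2) ndvd by blast
  ultimately show "(x, y) \<in> ?R"
    using ndvd mem_generate_iff_ord_dvd[OF a] by (auto simp: incomparable_def)
qed

section \<open>Counting the vertices by their orders\<close>

lemma card_generators:
  assumes a: "a \<in> carrier G" "ord a \<noteq> 0"
  shows "card {x \<in> generate G {a}. ord x = ord a} = totient (ord a)"
proof -
  have iff: "ord (a [^] i) = ord a \<longleftrightarrow> coprime i (ord a)" if "i > 0" for i
    using that a by (auto simp: div_eq_dividend_iff ord_pow_gen coprime_iff_gcd_eq_1 gcd.commute)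
  have "{x \<in> generate G {a}. ord x = ord a} = (\<lambda>i. a [^] i) ` totatives (ord a)"
    unfolding generate_eq_image_pow[OF a] totatives_def using iff by auto
  moreover have "inj_on (\<lambda>i. a [^] i) (totatives (ord a))"
    by (rule inj_on_subset[OF ord_inj'[OF a(1)]]) (auto simp: totatives_def)
  ultimately show ?thesis by (simp add: card_image totient_def)
qed

lemma ord_image_generate:
  assumes a: "a \<in> carrier G" "ord a \<noteq> 0"
  shows "ord ` generate G {a} = {d. d dvd ord a}"
proof (intro equalityI subsetI)
  fix d assume "d \<in> {d. d dvd ord a}"
  then obtain k where k: "ord a = d * k" by auto
  then have "k \<noteq> 0" using a(2) by auto
  then have "ord (a [^] k) = d" using ord_pow[OF a(1), of k] k by simp
  moreover have "a [^] k \<in> generate G {a}" using generate_pow_nat[OF a] by auto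
  ultimately show "d \<in> ord ` generate G {a}" by blast
qed (use a ord_dvd_of_mem_generate in auto)

text \<open>There are \<open>m - totient m - 1\<close> vertices and
  \<open>divisor_count m - 2\<close> colours; the additive form avoids truncated
  subtraction.\<close>

lemma metric_dimension_difference_graph:
  fixes a :: 'a
  defines "m \<equiv> ord a"
  assumes a: "a \<in> carrier G"
    and m: "m > 0" "4 dvd m" "\<And>p k. Factorial_Ring.prime p \<Longrightarrow> m \<noteq> p ^ k"
    and outside: "\<And>x c. x \<in> carrier G \<Longrightarrow> c \<in> carrier G \<Longrightarrow> x \<notin> generate G {a} \<Longrightarrow>
      x \<in> generate G {c} \<Longrightarrow> c \<in> generate G {x}"
  shows "metric_dimension (difference_graph G) + totient m + divisor_count m = m + 1 +
    (if \<exists>k q. k > 1 \<and> Factorial_Ring.prime q \<and> q \<noteq> 2 \<and> m = 2 ^ k * q then 1 else 0)"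
proof -
  let ?A = "generate G {a}" and ?D = "difference_graph G"
  have ord_a: "ord a \<noteq> 0" using m(1) by (simp add: m_def)
  have carrier: "?A \<subseteq> carrier G" using a by (simp add: generate_incl)
  have card_A: "card ?A = m" using generate_pow_card[OF a] by (simp add: m_def)
  have fin: "finite ?A" using card_A m(1) by (metis card.infinite less_irrefl)
  have m2: "m \<noteq> 1" using m(2) by auto
  note arcs = parcs_difference_graph[OF a ord_a outside]
  have ord_dvd: "ord x dvd m" if "x \<in> ?A" for x
    using ord_dvd_of_mem_generate[OF a that] by (simp add: m_def)
  have ords: "ord ` ?A = {d. d dvd m}" using ord_image_generate[OF a ord_a] by (simp add: m_def)
  have verts: "pverts ?D = {x \<in> ?A. ord x \<in> proper_divisors m}"
  proof -
    have "pverts ?D = {x \<in> carrier G. \<exists>y. (x, y) \<in> parcs ?D}"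
      by (simp add: difference_graph_def delete_isolated_def remove_edges_def enhanced_power_graph_def)
    also have "\<dots> = {x \<in> ?A. \<exists>y\<in>?A. incomparable (ord x) (ord y)}"
      using carrier by (auto simp: arcs)
    also have "\<dots> = {x \<in> ?A. ord x \<in> proper_divisors m}"
    proof (intro Collect_cong conj_cong refl iffI)
      fix x assume x: "x \<in> ?A"
      show "ord x \<in> proper_divisors m" if "\<exists>y\<in>?A. incomparable (ord x) (ord y)"
        using that ord_dvd x by (auto simp: proper_divisors_def incomparable_def)
      show "\<exists>y\<in>?A. incomparable (ord x) (ord y)" if "ord x \<in> proper_divisors m"
      proof -
        obtain e where e: "e \<in> proper_divisors m" "incomparable (ord x) e"
          using incomparable_exists[OF m(1,3) \<open>ord x \<in> proper_divisors m\<close>] by blast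
        then have "e \<in> ord ` ?A" by (simp add: ords proper_divisors_def)
        then show ?thesis using e(2) by blast
      qed
    qed
    finally show ?thesis .
  qed
  have card_verts: "card (pverts ?D) + totient m + 1 = m"
  proof -
    let ?B = "{x \<in> ?A. ord x = m}"
    \<comment> \<open>The elements of \<open>\<langle>a\<rangle>\<close> that are not vertices are
      the identity and the generators.\<close>
    have A: "?A = insert \<one> (pverts ?D \<union> ?B)"
      using ord_dvd generate.one[of G "{a}"] carrier ord_eq_1
      by (auto simp: verts proper_divisors_def)
    have "\<one> \<notin> pverts ?D \<union> ?B" using m2 by (auto simp: verts proper_divisors_def)
    moreover have "pverts ?D \<inter> ?B = {}" by (auto simp: verts proper_divisors_def)
    moreover have "finite (pverts ?D)" "finite ?B" using fin by (auto simp: verts)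
    moreover have "card ?B = totient m" using card_generators[OF a ord_a] by (simp add: m_def)
    ultimately have "card (insert \<one> (pverts ?D \<union> ?B)) = card (pverts ?D) + totient m + 1"
      by (simp only: card_insert_disjoint finite_Un card_Un_disjoint simp_thms Suc_eq_plus1)
    then show ?thesis using card_A A by simp
  qed
  interpret divisor_colored_graph ?D ord m
  proof unfold_locales
    fix e assume "e \<in> parcs ?D"
    then obtain x y where e: "e = (x, y)" "x \<in> ?A" "y \<in> ?A" "incomparable (ord x) (ord y)"
      by (auto simp: arcs)
    then show "fst e \<in> pverts ?D" "snd e \<in> pverts ?D"
      using ord_dvd[of x] ord_dvd[of y] by (auto simp: verts proper_divisors_def incomparable_def)
  next
    show "finite (pverts ?D)" using fin by (simp add: verts)
  next
    fix x y
    show "(x, y) \<in> parcs ?D \<longleftrightarrow> x \<in> pverts ?D \<and> y \<in> pverts ?D \<and> incomparable (ord x) (ord y)"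
      using ord_dvd by (auto simp: arcs verts proper_divisors_def incomparable_def)
  next
    have "proper_divisors m \<subseteq> ord ` ?A" by (auto simp: ords proper_divisors_def)
    then show "ord ` pverts ?D = proper_divisors m" by (auto simp: verts)
  next
    fix x assume x: "x \<in> pverts ?D" "ord x \<noteq> 2"
    then have xA: "x \<in> ?A" and xG: "x \<in> carrier G" and "ord x \<noteq> 1"
      using carrier by (auto simp: verts proper_divisors_def)
    \<comment> \<open>The inverse serves as the second vertex of the same order.\<close>
    have "inv x \<noteq> x"
    proof
      assume "inv x = x"
      then have "x [^] (2::nat) = \<one>" using xG by (metis r_inv numeral_2_eq_2 nat_pow_Suc nat_pow_eone nat_pow_0 l_one)
      then have "ord x dvd 2" using xG by (simp add: pow_eq_id)
      then show False using x(2) \<open>ord x \<noteq> 1\<close> two_is_prime_nat unfolding prime_nat_iff by blast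
    qed
    moreover have "inv x \<in> ?A" using a xA by (simp add: generate_m_inv_closed)
    ultimately show "\<exists>y\<in>pverts ?D. y \<noteq> x \<and> ord y = ord x"
      using x xG by (intro bexI[of _ "inv x"]) (auto simp: verts)
  next
    fix x y assume x: "x \<in> pverts ?D" "ord x = 2" and y: "y \<in> pverts ?D" "ord y = 2"
    then have xA: "x \<in> ?A" "y \<in> ?A" and xG: "x \<in> carrier G" "y \<in> carrier G"
      using carrier by (auto simp: verts)
    \<comment> \<open>Equal orders put \<open>x\<close> into the subgroup generated by
      \<open>y\<close>, which consists of \<open>y\<close> and the identity.\<close>
    have "x \<in> generate G {y}" using mem_generate_iff_ord_dvd[OF a ord_a xA] x y by simp
    moreover have "{0<..2} = {1, 2::nat}" by auto
    ultimately have "x = y \<or> x = y [^] (2::nat)"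
      using generate_eq_image_pow[OF xG(2)] y(2) xG(2) by auto
    moreover have "y [^] (2::nat) = \<one>" using pow_ord_eq_1[OF xG(2)] y(2) by simp
    ultimately show "x = y" using x(2) by auto
  qed (use m in auto)
  have "card (proper_divisors m) + 2 = divisor_count m"
    using m(1) m2 by (intro card_proper_divisors) auto
  note card = this card_verts
  show ?thesis
  proof (cases "\<exists>k q. k > 1 \<and> Factorial_Ring.prime q \<and> q \<noteq> 2 \<and> m = 2 ^ k * q")
    case True
    then have "metric_dimension ?D + card (proper_divisors m) = card (pverts ?D) + 1"
      using metric_dimension_special by blast
    then show ?thesis using card by (simp only: True if_True)
  next
    case False
    then have "metric_dimension ?D + card (proper_divisors m) = card (pverts ?D)"
      by (rule metric_dimension_generic)
    then show ?thesis using card by (simp only: False if_False)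
  qed
qed

text \<open>The Chinese remainder theorem. With exponent \<open>u s + v r\<close>, reducing
  \<open>u\<close> modulo \<open>r\<close> or \<open>v\<close> modulo \<open>s\<close> changes it by
  a multiple of \<open>r s\<close>, so no Bezout coefficients enter; coprimality gives injectivity,
  and counting gives surjectivity.\<close>

lemma subgroup_generated_iso_DirProd:
  assumes a: "a \<in> carrier G" "ord a = r * s" and "coprime r s" "r > 0" "s > 0"
  shows "subgroup_generated G {a} \<cong> integer_mod_group r \<times>\<times> integer_mod_group s"
proof -
  let ?H = "subgroup_generated G {a}" and ?P = "integer_mod_group r \<times>\<times> integer_mod_group s"
  define f where "f = (\<lambda>(u, v). a [^] (u * int s + v * int r))"
  have carrier_H: "carrier ?H = generate G {a}" using a by (simp add: carrier_subgroup_generated)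
  have carrier_P: "carrier ?P = {0..<int r} \<times> {0..<int s}"
    using assms by (simp add: carrier_integer_mod_group)
  then have card_P: "card (carrier ?P) = r * s" by (simp only: card_cartesian_product card_atLeastLessThan_int) simp
  have "f \<in> hom ?P ?H"
  proof (rule homI)
    fix x show "f x \<in> carrier ?H"
      using generate_pow[OF a(1)] by (auto simp: carrier_H f_def split: prod.split)
  next
    fix x y
    obtain u v u' v' :: int where xy: "x = (u, v)" "y = (u', v')" by (metis surj_pair)
    let ?i = "(u + u') mod int r * int s + (v + v') mod int s * int r"
    let ?j = "(u * int s + v * int r) + (u' * int s + v' * int r)"
    have "?j - ?i = (u + u' - (u + u') mod int r) * int s + (v + v' - (v + v') mod int s) * int r"
      by (simp add: algebra_simps)
    also have "\<dots> = int (r * s) * ((u + u') div int r + (v + v') div int s)"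
      by (simp add: minus_mod_eq_mult_div algebra_simps)
    finally have "int (r * s) dvd ?j - ?i" by simp
    then have "a [^] ?i = a [^] ?j" using a by (simp only: int_pow_eq)
    then show "f (x \<otimes>\<^bsub>?P\<^esub> y) = f x \<otimes>\<^bsub>?H\<^esub> f y"
      using a(1) by (simp add: xy f_def int_pow_mult)
  qed
  moreover have inj: "inj_on f (carrier ?P)"
  proof (rule inj_onI)
    fix x y assume x: "x \<in> carrier ?P" and y: "y \<in> carrier ?P" and eq: "f x = f y"
    obtain u v u' v' :: int where xy: "x = (u, v)" "y = (u', v')" by (metis surj_pair)
    have range: "0 \<le> u" "u < r" "0 \<le> u'" "u' < r" "0 \<le> v" "v < s" "0 \<le> v'" "v' < s"
      using x y unfolding carrier_P xy by auto
    have "int (r * s) dvd (u' * int s + v' * int r) - (u * int s + v * int r)"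
      using eq a by (simp add: xy f_def int_pow_eq)
    then have dvd: "int r * int s dvd (u' - u) * int s + (v' - v) * int r" by (simp add: algebra_simps)
    have "int r dvd (u' - u) * int s"
      using dvd_mult_left[OF dvd] by (simp add: dvd_add_left_iff)
    then have "int r dvd u' - u" using assms(3) by (simp add: coprime_dvd_mult_left_iff)
    moreover have "int s dvd (v' - v) * int r"
      using dvd_mult_right[OF dvd] by (simp add: dvd_add_right_iff)
    then have "int s dvd v' - v" using assms(3) by (simp add: coprime_dvd_mult_left_iff coprime_commute)
    ultimately have "u' mod int r = u mod int r" "v' mod int s = v mod int s"
      by (simp_all add: mod_eq_dvd_iff)
    then show "x = y" using range by (simp add: xy)
  qed
  moreover have "f ` carrier ?P = carrier ?H"
  proof (rule card_subset_eq)
    have "card (generate G {a}) = r * s" using generate_pow_card[OF a(1)] a(2) by simp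
    then show "card (f ` carrier ?P) = card (carrier ?H)"
      using card_image[OF inj] card_P by (simp only: carrier_H)
    then show "finite (carrier ?H)"
      using \<open>card (generate G {a}) = r * s\<close> assms(4,5) by (intro card_ge_0_finite) (simp add: carrier_H)
    show "f ` carrier ?P \<subseteq> carrier ?H" using \<open>f \<in> hom ?P ?H\<close> by (auto simp: hom_def)
  qed
  ultimately have "f \<in> iso ?P ?H" by (simp add: iso_def bij_betw_def)
  then have "?P \<cong> ?H" by (auto simp: is_iso_def)
  then show ?thesis using group.iso_sym[of ?P ?H] by (simp add: DirProd_group)
qed

section \<open>Elements outside the cyclic subgroup of rotations\<close>

lemma pow_conjugate:
  fixes a b :: 'a and j k :: nat
  assumes ab: "a \<in> carrier G" "b \<in> carrier G" and ba: "b \<otimes> a = a [^] k \<otimes> b"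
  shows "b \<otimes> a [^] j = a [^] (k * j) \<otimes> b"
proof (induction j)
  case (Suc j)
  have "b \<otimes> a [^] Suc j = b \<otimes> a [^] j \<otimes> a" using ab by (simp add: m_assoc)
  also have "\<dots> = a [^] (k * j) \<otimes> (b \<otimes> a)" using ab by (simp add: Suc m_assoc)
  also have "\<dots> = a [^] (k * j) \<otimes> a [^] k \<otimes> b" using ab by (simp add: ba m_assoc)
  also have "\<dots> = a [^] (k * Suc j) \<otimes> b" using ab by (simp add: nat_pow_mult add.commute)
  finally show ?case .
qed (use ab in auto)

text \<open>Here \<open>c = a [^] i \<otimes> b\<close>, so \<open>c\<close> has its square in
  \<open>\<langle>a\<rangle>\<close> and its fourth power trivial. Hence \<open>x\<close> is an odd
  power of \<open>c\<close>, and an odd \<open>k\<close> satisfies \<open>k k = 1\<close> modulo 4,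
  so \<open>x [^] k = c\<close>.\<close>

lemma mem_generate_sym_outside:
  fixes a b :: 'a and n :: nat
  assumes ab: "a \<in> carrier G" "b \<in> carrier G" and a4n: "a [^] (4 * n) = \<one>"
    and bb: "b \<otimes> b = \<one>" and ba: "b \<otimes> a = a [^] (2 * n - 1) \<otimes> b"
    and elements: "\<And>x. x \<in> carrier G \<Longrightarrow> \<exists>i::nat. x = a [^] i \<or> x = a [^] i \<otimes> b"
    and x: "x \<in> carrier G" "x \<notin> generate G {a}" and c: "c \<in> carrier G" "x \<in> generate G {c}"
    and "n > 0"
  shows "c \<in> generate G {x}"
proof -
  have pow_mem: "a [^] (i::nat) \<in> generate G {a}" for i
  proof -
    have "a [^] int i \<in> generate G {a}" unfolding generate_pow[OF ab(1)] by blast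
    then show ?thesis by (simp only: int_pow_int)
  qed
  have sub: "subgroup (generate G {a}) G" using ab by (intro generate_is_subgroup) auto
  have "c \<notin> generate G {a}"
  proof
    assume "c \<in> generate G {a}"
    then have "generate G {c} \<subseteq> generate G {a}" using sub by (intro generate_subgroup_incl) auto
    then show False using x c by blast
  qed
  then obtain i :: nat where ci: "c = a [^] i \<otimes> b" using elements[OF c(1)] pow_mem by blast
  note conj = pow_conjugate[OF ab ba]
  have "c \<otimes> c = a [^] i \<otimes> (b \<otimes> a [^] i) \<otimes> b" using ab by (simp add: ci m_assoc)
  also have "\<dots> = a [^] i \<otimes> a [^] ((2 * n - 1) * i)" using ab bb by (simp add: conj m_assoc)
  also have "\<dots> = a [^] (i + (2 * n - 1) * i)" using ab by (simp add: nat_pow_mult)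
  also have "i + (2 * n - 1) * i = 2 * n * i" using \<open>n > 0\<close> by (cases n) auto
  finally have cc: "c \<otimes> c = a [^] (2 * n * i)" .
  have c2: "c [^] (2::int) = a [^] (2 * n * i)"
    using c(1) cc int_pow_int[of G c 2] by (simp add: numeral_2_eq_2)
  have "c [^] (4::int) = (a [^] (2 * n * i)) [^] (2::int)"
    using int_pow_pow[OF c(1), of 2 2] c2 by simp
  also have "\<dots> = (a [^] (4 * n)) [^] i"
    using ab int_pow_int[of G "a [^] (2 * n * i)" 2] by (simp add: nat_pow_pow ac_simps)
  finally have c4: "c [^] (4::int) = \<one>" using a4n by simp
  obtain k :: int where k: "x = c [^] k" using c generate_pow by blast
  have "odd k"
  proof
    assume "even k"
    then obtain l where "k = 2 * l" by blast
    then have "x = (a [^] (2 * n * i)) [^] l" using c(1) c2 by (simp add: k int_pow_pow[symmetric])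
    also have "\<dots> \<in> generate G {a}"
      using sub pow_mem by (rule group.subgroup_int_pow_closed[OF is_group])
    finally show False using x(2) by simp
  qed
  then obtain l where l: "k = 2 * l + 1" by (rule oddE)
  have "x [^] k = c [^] (4 * (l * l + l) + 1)" using c(1) by (simp add: k int_pow_pow l algebra_simps)
  also have "\<dots> = (c [^] (4::int)) [^] (l * l + l) \<otimes> c" using c(1) by (simp add: int_pow_mult int_pow_pow)
  also have "\<dots> = c" using c(1) by (simp add: c4 int_pow_one)
  finally show ?thesis using generate_pow[OF x(1)] by blast
qed

end

section \<open>The semidihedral group\<close>

text \<open>
  The generator \<open>a\<close> acts as \<open>x \<mapsto> x + 1\<close> and \<open>b\<close> as \<open>x \<mapsto> (2n - 1) x\<close> on the integers
  modulo \<open>4n\<close>; this action bounds the order of \<open>a\<close> from below.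
\<close>

fun sd_act :: "nat \<Rightarrow> sd_gen word \<Rightarrow> int \<Rightarrow> int" where
  "sd_act n [] x = x"
| "sd_act n ((Gen_a, s) # w) x = sd_act n w x + (if s then 1 else -1)"
| "sd_act n ((Gen_b, s) # w) x = (2 * int n - 1) * sd_act n w x"

lemma sd_act_append: "sd_act n (u @ v) x = sd_act n u (sd_act n v x)"
  by (induction n u x rule: sd_act.induct) simp_all

text \<open>The action is written on integers, so the relations hold only up to congruence; this
  carries a congruence through the letters further left in a word.\<close>

lemma sd_act_cong: "[x = y] (mod k) \<Longrightarrow> [sd_act n w x = sd_act n w y] (mod k)"
  by (induction n w x rule: sd_act.induct) (auto intro!: cong_add cong_diff cong_mult)

lemma sd_act_replicate_a: "sd_act n (replicate i (Gen_a, True)) x = x + int i"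
  by (induction i) auto

text \<open>Since \<open>2 n - 1\<close> is its own inverse modulo \<open>4 n\<close>,
  \<open>Gen_b\<close> and its formal inverse may act by the same formula.\<close>

lemma sd_act_b_twice: "[(2 * int n - 1) * ((2 * int n - 1) * x) = x] (mod 4 * int n)"
proof -
  have "(2 * int n - 1) * ((2 * int n - 1) * x) - x = 4 * int n * ((int n - 1) * x)"
    by (simp add: algebra_simps)
  then show ?thesis unfolding cong_iff_dvd_diff by simp
qed

lemma sd_act_relation:
  assumes "(l, r) \<in> semidihedral_relations n" "n > 0"
  shows "[sd_act n l x = sd_act n r x] (mod 4 * int n)"
proof -
  consider "l = replicate (4 * n) (Gen_a, True)" "r = []"
    | "l = [(Gen_b, True), (Gen_b, True)]" "r = []"
    | "l = [(Gen_b, True), (Gen_a, True)]" "r = replicate (2 * n - 1) (Gen_a, True) @ [(Gen_b, True)]"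
    using assms(1) by (auto simp: semidihedral_relations_def numeral_2_eq_2)
  then show ?thesis
  proof cases
    case 1
    then show ?thesis by (simp add: sd_act_replicate_a cong_def)
  next
    case 2
    then show ?thesis using sd_act_b_twice by simp
  next
    case 3
    have "int (2 * n - 1) = 2 * int n - 1" using \<open>n > 0\<close> by simp
    then have "sd_act n l x = sd_act n r x"
      by (simp add: 3 sd_act_append sd_act_replicate_a algebra_simps)
    then show ?thesis by simp
  qed
qed

lemma sd_act_pres_eq:
  assumes "pres_eq (semidihedral_relations n) u v" "n > 0"
  shows "[sd_act n u x = sd_act n v x] (mod 4 * int n)"
  using assms(1)
proof (induction arbitrary: x rule: pres_eq.induct)
  case (pres_cancel u g s v)
  have "[sd_act n [(g, s), (g, \<not> s)] y = y] (mod 4 * int n)" for y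
    by (cases g) (use sd_act_b_twice in auto)
  then show ?case by (simp only: sd_act_append sd_act_cong)
next
  case (pres_relation l r u v)
  then show ?case using sd_act_relation \<open>n > 0\<close> by (simp add: sd_act_append sd_act_cong)
qed (auto intro: cong_sym cong_trans)

definition semidihedral_b :: "nat \<Rightarrow> sd_gen word set" where
  "semidihedral_b n = pres_class (semidihedral_relations n) [(Gen_b, True)]"

section \<open>Structure of the group derived from its presentation\<close>

context
  fixes n :: nat and G :: "sd_gen word set monoid" (structure) and a b :: "sd_gen word set"
  assumes n_pos: "n > 0"
  defines G_def: "G \<equiv> semidihedral n"
    and a_def: "a \<equiv> semidihedral_a n"
    and b_def: "b \<equiv> semidihedral_b n"
begin

interpretation group G
  by (simp add: G_def semidihedral_def group_presented_group)

lemma semidihedral_generators_closed: "a \<in> carrier G" "b \<in> carrier G"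
  by (simp_all add: G_def a_def b_def semidihedral_def semidihedral_a_def semidihedral_b_def
      carrier_presented_group)

lemma semidihedral_mult:
  "pres_class (semidihedral_relations n) u \<otimes> pres_class (semidihedral_relations n) v =
    pres_class (semidihedral_relations n) (u @ v)"
  by (simp add: G_def semidihedral_def presented_group_mult)

lemma semidihedral_one: "\<one> = pres_class (semidihedral_relations n) []"
  by (simp add: G_def semidihedral_def one_presented_group)

lemma semidihedral_a_pow:
  "a [^] i = pres_class (semidihedral_relations n) (replicate i (Gen_a, True))" for i :: nat
proof (induction i)
  case (Suc i)
  then show ?case
    by (simp add: a_def semidihedral_a_def semidihedral_mult replicate_append_same)
qed (simp add: semidihedral_one)

lemma semidihedral_relation:
  "(l, r) \<in> semidihedral_relations n \<Longrightarrow>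
    pres_class (semidihedral_relations n) l = pres_class (semidihedral_relations n) r"
  using pres_relation[of l r "semidihedral_relations n" "[]" "[]"] by (simp add: pres_class_eq_iff)

lemma semidihedral_a_pow_4n: "a [^] (4 * n) = \<one>"
  unfolding semidihedral_a_pow semidihedral_one
  by (rule semidihedral_relation) (simp add: semidihedral_relations_def)

lemma semidihedral_b_square: "b \<otimes> b = \<one>"
  unfolding b_def semidihedral_b_def semidihedral_one semidihedral_mult
  by (rule semidihedral_relation) (simp add: semidihedral_relations_def numeral_2_eq_2)

lemma semidihedral_ba: "b \<otimes> a = a [^] (2 * n - 1) \<otimes> b"
  unfolding semidihedral_a_pow unfolding a_def b_def semidihedral_a_def semidihedral_b_def semidihedral_mult
  by (rule semidihedral_relation) (simp add: semidihedral_relations_def)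

lemma ord_semidihedral_a: "ord a = 4 * n"
proof (rule dvd_antisym)
  show "ord a dvd 4 * n" using semidihedral_a_pow_4n semidihedral_generators_closed by (simp add: pow_eq_id)
  have "a [^] ord a = \<one>" using semidihedral_generators_closed by simp
  then have "pres_eq (semidihedral_relations n) (replicate (ord a) (Gen_a, True)) []"
    by (simp only: semidihedral_a_pow semidihedral_one pres_class_eq_iff)
  \<comment> \<open>The word for \<open>a [^] ord a\<close> moves 0 to \<open>ord a\<close>, while
    the empty word fixes it.\<close>
  from sd_act_pres_eq[OF this n_pos, of 0] have "[int (ord a) = 0] (mod int (4 * n))"
    by (simp add: sd_act_replicate_a)
  then show "4 * n dvd ord a" by (simp only: cong_0_iff int_dvd_int_iff)
qed

text \<open>Induction on words: left multiplication by a letter preserves the normal form. Inverse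
  letters are first rewritten as nonnegative powers of \<open>a\<close> or as
  \<open>b\<close>.\<close>

lemma semidihedral_elements:
  assumes "x \<in> carrier G"
  shows "\<exists>i::nat. x = a [^] i \<or> x = a [^] i \<otimes> b"
proof -
  obtain w where x: "x = pres_class (semidihedral_relations n) w"
    using assms by (auto simp: G_def semidihedral_def carrier_presented_group)
  note conj = pow_conjugate[OF semidihedral_generators_closed semidihedral_ba]
  have inv_a: "inv a = a [^] (4 * n - 1)"
  proof (rule inv_equality)
    have "a [^] (4 * n - 1) \<otimes> a = a [^] Suc (4 * n - 1)" using semidihedral_generators_closed by simp
    then show "a [^] (4 * n - 1) \<otimes> a = \<one>" using n_pos semidihedral_a_pow_4n by simp
  qed (use semidihedral_generators_closed in auto)
  have inv_b: "inv b = b" using semidihedral_generators_closed semidihedral_b_square by (simp add: inv_equality)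
  have left_mult: "\<exists>i::nat. g \<otimes> y = a [^] i \<or> g \<otimes> y = a [^] i \<otimes> b"
    if g: "g \<in> {a, inv a, b, inv b}" and y: "\<exists>i::nat. y = a [^] i \<or> y = a [^] i \<otimes> b" for g y
  proof -
    have "a = a [^] (1::nat)" using semidihedral_generators_closed by simp
    then have "g = b \<or> (\<exists>j::nat. g = a [^] j)" using g inv_a inv_b by (metis insertE singletonD)
    then show ?thesis
    proof (elim disjE exE)
      assume g: "g = b"
      from y show ?thesis
      proof (elim exE disjE)
        fix i :: nat assume "y = a [^] i"
        then show ?thesis using conj by (auto simp: g)
      next
        fix i :: nat assume "y = a [^] i \<otimes> b"
        then have "g \<otimes> y = b \<otimes> a [^] i \<otimes> b" using semidihedral_generators_closed by (simp add: g m_assoc)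
        also have "\<dots> = a [^] ((2 * n - 1) * i)" using semidihedral_generators_closed by (simp add: conj semidihedral_b_square m_assoc)
        finally show ?thesis by blast
      qed
    next
      fix j :: nat assume g: "g = a [^] j"
      from y show ?thesis
      proof (elim exE disjE)
        fix i :: nat assume "y = a [^] i"
        then have "g \<otimes> y = a [^] (j + i)" using semidihedral_generators_closed by (simp add: g nat_pow_mult)
        then show ?thesis by blast
      next
        fix i :: nat assume "y = a [^] i \<otimes> b"
        then have "g \<otimes> y = a [^] (j + i) \<otimes> b"
          using semidihedral_generators_closed by (simp add: g nat_pow_mult m_assoc[symmetric])
        then show ?thesis by blast
      qed
    qed
  qed
  have letter: "pres_class (semidihedral_relations n) [e] \<in> {a, inv a, b, inv b}" for e
  proof -
    obtain g s where e: "e = (g, s)" by force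
    have "pres_class (semidihedral_relations n) [(g, False)] = inv (pres_class (semidihedral_relations n) [(g, True)])"
    proof (rule inv_equality[symmetric])
      show "pres_class (semidihedral_relations n) [(g, False)] \<otimes> pres_class (semidihedral_relations n) [(g, True)] = \<one>"
        using pres_cancel[of "semidihedral_relations n" "[]" g False "[]"]
        by (simp add: semidihedral_mult semidihedral_one pres_class_eq_iff)
    qed (simp_all add: G_def semidihedral_def carrier_presented_group)
    then show ?thesis
      by (cases g; cases s) (simp_all add: e a_def b_def semidihedral_a_def semidihedral_b_def)
  qed
  have "\<exists>i::nat. pres_class (semidihedral_relations n) w = a [^] i \<or>
      pres_class (semidihedral_relations n) w = a [^] i \<otimes> b"
  proof (induction w)
    case Nil
    show ?case by (metis nat_pow_0 semidihedral_one)
  next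
    case (Cons e w)
    from left_mult[OF letter Cons, of e] show ?case by (simp add: semidihedral_mult)
  qed
  then show ?thesis by (simp add: x)
qed

text \<open>This turns the isomorphism condition into arithmetic: one direction compares
  cardinalities, the other is the Chinese remainder theorem.\<close>

lemma semidihedral_a_iso_iff:
  assumes "k > 1" "Factorial_Ring.prime p" "p \<noteq> 2"
  shows "subgroup_generated G {a} \<cong> integer_mod_group (2 ^ k) \<times>\<times> integer_mod_group p \<longleftrightarrow>
    4 * n = 2 ^ k * p"
proof
  assume iso: "subgroup_generated G {a} \<cong> integer_mod_group (2 ^ k) \<times>\<times> integer_mod_group p"
  have "card (carrier (subgroup_generated G {a})) = 4 * n"
    using semidihedral_generators_closed generate_pow_card[of a] ord_semidihedral_a by (simp add: carrier_subgroup_generated)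
  moreover have "card (carrier (integer_mod_group (2 ^ k) \<times>\<times> integer_mod_group p)) = 2 ^ k * p"
    using assms(2) by (simp add: carrier_integer_mod_group prime_gt_0_nat)
  ultimately show "4 * n = 2 ^ k * p" using iso_same_card[OF iso] by simp
next
  assume "4 * n = 2 ^ k * p"
  moreover have "coprime (2 ^ k) p"
    using assms(2,3) primes_dvd_imp_eq[OF two_is_prime_nat] by auto
  ultimately show "subgroup_generated G {a} \<cong> integer_mod_group (2 ^ k) \<times>\<times> integer_mod_group p"
    using subgroup_generated_iso_DirProd[OF semidihedral_generators_closed(1), of "2 ^ k" p] prime_gt_0_nat[OF assms(2)]
    by (simp only: ord_semidihedral_a) simp
qed

lemma semidihedral_outside:
  assumes "x \<in> carrier G" "c \<in> carrier G" "x \<notin> generate G {a}" "x \<in> generate G {c}"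
  shows "c \<in> generate G {x}"
  using semidihedral_generators_closed semidihedral_a_pow_4n semidihedral_b_square semidihedral_ba semidihedral_elements
    assms(1,3,2,4) n_pos
  by (rule mem_generate_sym_outside)

text \<open>Divisors of a prime power form a chain, so no two orders would be incomparable and the
  graph would have no arcs.\<close>

lemma not_prime_power_of_verts:
  assumes "pverts (difference_graph G) \<noteq> {}" "Factorial_Ring.prime p"
  shows "4 * n \<noteq> p ^ k"
proof
  assume n: "4 * n = p ^ k"
  have "parcs (difference_graph G) \<noteq> {}"
    using assms(1) by (auto simp: difference_graph_def delete_isolated_def)
  then obtain x y where xy: "x \<in> generate G {a}" "y \<in> generate G {a}" "incomparable (ord x) (ord y)"
    using parcs_difference_graph[OF semidihedral_generators_closed(1) _ semidihedral_outside] n_pos ord_semidihedral_a by auto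
  then have "ord x dvd p ^ k" "ord y dvd p ^ k"
    using ord_dvd_of_mem_generate[OF semidihedral_generators_closed(1)] by (simp_all add: ord_semidihedral_a n)
  then obtain i j where "ord x = p ^ i" "ord y = p ^ j"
    using assms(2) divides_primepow_nat by metis
  then show False using xy(3) nat_le_linear[of i j] by (auto simp: incomparable_def le_imp_power_dvd)
qed

lemma semidihedral_metric_dimension:
  assumes "\<And>p k. Factorial_Ring.prime p \<Longrightarrow> 4 * n \<noteq> p ^ k"
  shows "metric_dimension (difference_graph G) + totient (4 * n) + divisor_count (4 * n) = 4 * n + 1 +
    (if \<exists>k q. k > 1 \<and> Factorial_Ring.prime q \<and> q \<noteq> 2 \<and> 4 * n = 2 ^ k * q then 1 else 0)"
proof -
  have "4 * n > 0" "4 dvd 4 * n" using n_pos by simp_all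
  with semidihedral_generators_closed(1) show ?thesis
    using assms semidihedral_outside
    by (rule metric_dimension_difference_graph[of a, unfolded ord_semidihedral_a])
qed

end

text \<open>The second part supposes a vertex: when \<open>n\<close> is a power of 2 the graph is
  empty and has metric dimension 0, whereas the formula gives a positive number. Subtraction is
  taken over the integers.\<close>

theorem theorem2p12:
  fixes n :: nat
  assumes "n \<ge> 2"
  shows
    "((\<exists>k p :: nat. k > 1 \<and> Factorial_Ring.prime p \<and> p \<noteq> 2 \<and>
        subgroup_generated (semidihedral n) {semidihedral_a n} \<cong>
          integer_mod_group (2 ^ k) \<times>\<times> integer_mod_group p)
      \<longrightarrow> int (metric_dimension (difference_graph (semidihedral n))) =
          4 * int n - int (totient (4 * n)) - int (divisor_count (4 * n)) + 2)
    \<and>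
    (\<not> (\<exists>k p :: nat. k > 1 \<and> Factorial_Ring.prime p \<and> p \<noteq> 2 \<and>
        subgroup_generated (semidihedral n) {semidihedral_a n} \<cong>
          integer_mod_group (2 ^ k) \<times>\<times> integer_mod_group p)
      \<longrightarrow> pverts (difference_graph (semidihedral n)) \<noteq> {}
      \<longrightarrow> int (metric_dimension (difference_graph (semidihedral n))) =
          4 * int n - int (totient (4 * n)) - int (divisor_count (4 * n)) + 1)"
proof -
  have n: "n > 0" using assms by simp
  let ?S = "\<exists>k q. k > 1 \<and> Factorial_Ring.prime q \<and> q \<noteq> 2 \<and> 4 * n = 2 ^ k * q"
  have iff: "(\<exists>k p :: nat. k > 1 \<and> Factorial_Ring.prime p \<and> p \<noteq> 2 \<and>
      subgroup_generated (semidihedral n) {semidihedral_a n} \<cong>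
        integer_mod_group (2 ^ k) \<times>\<times> integer_mod_group p) \<longleftrightarrow> ?S"
    using semidihedral_a_iso_iff[OF n] by blast
  \<comment> \<open>In the exceptional case \<open>4 n\<close> is divisible by the two distinct
    primes 2 and \<open>q\<close>.\<close>
  have special: "4 * n \<noteq> r ^ j" if S: ?S and r: "Factorial_Ring.prime r" for r j
  proof
    assume eq: "4 * n = r ^ j"
    obtain k q where kq: "k > 1" "Factorial_Ring.prime q" "q \<noteq> 2" "4 * n = 2 ^ k * q" using S by blast
    have "2 dvd r ^ j" unfolding eq[symmetric] by simp
    then have "r = 2" using r by (metis prime_dvd_power primes_dvd_imp_eq two_is_prime_nat)
    moreover have "q dvd r ^ j" unfolding eq[symmetric] kq(4) by simp
    then have "q = r" using r kq(2) by (metis prime_dvd_power primes_dvd_imp_eq)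
    ultimately show False using kq(3) by simp
  qed
  show ?thesis
    unfolding iff
  proof (intro conjI impI)
    assume S: ?S
    from semidihedral_metric_dimension[OF n special[OF S]]
    have "metric_dimension (difference_graph (semidihedral n)) + totient (4 * n) + divisor_count (4 * n) =
        4 * n + 2" by (simp only: if_P[OF S])
    then show "int (metric_dimension (difference_graph (semidihedral n))) =
        4 * int n - int (totient (4 * n)) - int (divisor_count (4 * n)) + 2" by linarith
  next
    assume S: "\<not> ?S" and "pverts (difference_graph (semidihedral n)) \<noteq> {}"
    from semidihedral_metric_dimension[OF n not_prime_power_of_verts[OF n this(2)]]
    have "metric_dimension (difference_graph (semidihedral n)) + totient (4 * n) + divisor_count (4 * n) =
        4 * n + 1" by (simp only: if_not_P[OF S])
    then show "int (metric_dimension (difference_graph (semidihedral n))) =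
        4 * int n - int (totient (4 * n)) - int (divisor_count (4 * n)) + 1" by linarith
  qed
qed

end
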